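(* Let $s, t \geq 2$ be integers. Every $K^{\ast}_{s,t}$-minor-free graph $G$ is isomorphic to a subgraph of $H \boxtimes P \boxtimes K_m$ for some path $P$ and some graph $H$ with $\mathrm{tw}(H) \leq s$, where $m := (t-1)\,\mathrm{ltw}(G)$.
   Context: All graphs are finite, simple and undirected. $\mathrm{tw}$ denotes treewidth. $K^{\ast}_{s,t}$ is the graph whose vertex-set is partitioned into $A \cup B$ with $|A| = s$, $|B| = t$, $A$ a clique, $B$ an independent set, and every vertex of $A$ adjacent to every vertex of $B$. A layering of $G$ is a partition $(V_1, V_2, \dots)$ of $V(G)$ such that for each edge $vw$ with $v \in V_i$, $w \in V_j$ we have $|i-j| \leq 1$. The layered treewidth $\mathrm{ltw}(G)$ is the minimum integer $k$ such that $G$ has a layering $\mathcal{L}$ and a tree-decomposition $(T,\mathcal{W})$ with $|L \cap W| \leq k$ for every layer $L$ and every bag $W$. The strong product $A \boxtimes B$ has vertex-set $V(A)\times V(B)$, where distinct $(v,x),(w,y)$ are adjacent if ($v=w$ and $xy\in E(B)$), or ($x=y$ and $vw\in E(A)$), or ($vw\in E(A)$ and $xy\in E(B)$). $K_m$ is the complete graph on $m$ vertices. *)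

theory Defs
  imports
    "Graph_Theory.Digraph_Component"
    "Graph_Theory.Digraph_Isomorphism"
    "HOL-Library.Disjoint_Sets"
begin

text \<open>
  Finite simple undirected graphs are finite, loop-free digraphs with a symmetric set of pairs as
  arcs, i.e. \<^const>\<open>pair_graph\<close> of \<^typ>\<open>'a pair_pre_digraph\<close>; the null graph is allowed.
\<close>

subsection \<open>Subgraphs and minors\<close>

definition iso_to_subgraph :: "'a pair_pre_digraph \<Rightarrow> 'b pair_pre_digraph \<Rightarrow> bool" where
  "iso_to_subgraph G X \<longleftrightarrow>
     (\<exists>G'. pair_graph G' \<and> subgraph (with_proj G') (with_proj X) \<and>
           digraph_iso (with_proj G) (with_proj G'))"

text \<open>
  The vertex arising from the contraction of the edge \<open>uv\<close> keeps the name \<open>u\<close>. Loops are dropped,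
  and parallel edges are merged since arcs form a set of pairs.
\<close>
definition contract_edge :: "'a pair_pre_digraph \<Rightarrow> 'a \<Rightarrow> 'a \<Rightarrow> 'a pair_pre_digraph" where
  "contract_edge G u v =
     (let f = id(v := u) in
      \<lparr> pverts = f ` pverts G,
        parcs = {(f x, f y) | x y. (x, y) \<in> parcs G \<and> f x \<noteq> f y} \<rparr>)"

inductive contracts_to :: "'a pair_pre_digraph \<Rightarrow> 'a pair_pre_digraph \<Rightarrow> bool" where
  refl: "contracts_to G G"
| step: "contracts_to G G' \<Longrightarrow> (u, v) \<in> parcs G' \<Longrightarrow> contracts_to G (contract_edge G' u v)"

definition is_minor :: "'b pair_pre_digraph \<Rightarrow> 'a pair_pre_digraph \<Rightarrow> bool" where
  "is_minor X G \<longleftrightarrow>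
     (\<exists>G' G''. pair_graph G' \<and> subgraph (with_proj G') (with_proj G) \<and>
               contracts_to G' G'' \<and> digraph_iso (with_proj X) (with_proj G''))"

abbreviation minor_free :: "'b pair_pre_digraph \<Rightarrow> 'a pair_pre_digraph \<Rightarrow> bool" where
  "minor_free X G \<equiv> \<not> is_minor X G"

subsection \<open>Particular graphs and the strong product\<close>

definition complete_graph :: "nat \<Rightarrow> nat pair_pre_digraph" where
  "complete_graph m =
     \<lparr> pverts = {..<m}, parcs = {(i, j). i < m \<and> j < m \<and> i \<noteq> j} \<rparr>"

definition path_graph :: "nat \<Rightarrow> nat pair_pre_digraph" where
  "path_graph n =
     \<lparr> pverts = {..<n}, parcs = {(i, j). i < n \<and> j < n \<and> (j = Suc i \<or> i = Suc j)} \<rparr>"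

text \<open>The graph $K^*_{s,t}$, with clique \<open>A\<close> and independent set \<open>B\<close>.\<close>
definition K_star :: "nat \<Rightarrow> nat \<Rightarrow> nat pair_pre_digraph" where
  "K_star s t =
     (let A = {..<s}; B = {s..<s + t} in
      \<lparr> pverts = A \<union> B,
        parcs = {(u, v). u \<in> A \<and> v \<in> A \<and> u \<noteq> v} \<union> A \<times> B \<union> B \<times> A \<rparr>)"

definition strong_product ::
    "'a pair_pre_digraph \<Rightarrow> 'b pair_pre_digraph \<Rightarrow> ('a \<times> 'b) pair_pre_digraph"
    (infixl \<open>\<boxtimes>\<close> 70) where
  "A \<boxtimes> B =
     \<lparr> pverts = pverts A \<times> pverts B,
       parcs = {((v, x), (w, y)). {v, w} \<subseteq> pverts A \<and> {x, y} \<subseteq> pverts B \<and> (v, x) \<noteq> (w, y) \<and>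
         (v = w \<and> (x, y) \<in> parcs B \<or>
          x = y \<and> (v, w) \<in> parcs A \<or>
          (v, w) \<in> parcs A \<and> (x, y) \<in> parcs B)} \<rparr>"

subsection \<open>Tree-decompositions, treewidth and layered treewidth\<close>

text \<open>
  The predicate \<^const>\<open>tree\<close> is unsuitable here: in a symmetric digraph each edge \<open>uv\<close> gives
  the directed cycle \<open>u, v, u\<close>. Cycles of an undirected graph have length at least 3.
\<close>
definition undirected_tree :: "'a pair_pre_digraph \<Rightarrow> bool" where
  "undirected_tree T \<longleftrightarrow>
     pair_graph T \<and> Digraph_Component.connected (with_proj T) \<and>
     \<not> (\<exists>p. pre_digraph.cycle (with_proj T) p \<and> length p \<ge> 3)"

text \<open>
  A graph that is \<^const>\<open>Digraph_Component.connected\<close> is non-empty, so that every vertex of \<open>G\<close>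
  lies in some bag.
\<close>
definition tree_decomposition ::
    "'a pair_pre_digraph \<Rightarrow> 'b pair_pre_digraph \<Rightarrow> ('b \<Rightarrow> 'a set) \<Rightarrow> bool" where
  "tree_decomposition G T W \<longleftrightarrow>
     undirected_tree T \<and>
     (\<forall>x \<in> pverts T. W x \<subseteq> pverts G) \<and>
     (\<forall>(v, w) \<in> parcs G. \<exists>x \<in> pverts T. v \<in> W x \<and> w \<in> W x) \<and>
     (\<forall>v \<in> pverts G.
        Digraph_Component.connected (with_proj T \<restriction> {x \<in> pverts T. v \<in> W x}))"

text \<open>
  The width is the maximum size of a bag minus 1, so the null graph has treewidth \<open>- 1\<close>. Every finite
  tree has an isomorphic copy with vertices in \<^typ>\<open>nat\<close>.
\<close>
definition treewidth :: "'a pair_pre_digraph \<Rightarrow> int" where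
  "treewidth G =
     int (LEAST k. \<exists>(T :: nat pair_pre_digraph) W.
            tree_decomposition G T W \<and> (\<forall>x \<in> pverts T. card (W x) \<le> k)) - 1"

text \<open>Layers may be empty.\<close>
definition layering :: "'a pair_pre_digraph \<Rightarrow> (nat \<Rightarrow> 'a set) \<Rightarrow> bool" where
  "layering G L \<longleftrightarrow>
     (\<Union>i. L i) = pverts G \<and> disjoint_family L \<and>
     (\<forall>i j v w. (v, w) \<in> parcs G \<and> v \<in> L i \<and> w \<in> L j \<longrightarrow> \<bar>int i - int j\<bar> \<le> 1)"

definition layered_treewidth :: "'a pair_pre_digraph \<Rightarrow> nat" where
  "layered_treewidth G =
     (LEAST k. \<exists>L (T :: nat pair_pre_digraph) W.
        layering G L \<and> tree_decomposition G T W \<and>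
        (\<forall>i. \<forall>x \<in> pverts T. card (L i \<inter> W x) \<le> k))"

end

theory Submission
  imports Defs
begin

text \<open>
  Fix a layering and a tree-decomposition attaining the layered treewidth. It suffices to partition
  \<open>V(G)\<close> into parts, each contained in the union of at most \<open>t - 1\<close> bags, such that the quotient graph has
  treewidth at most \<open>s\<close>: a part meets a layer in at most \<open>(t - 1) ltw(G)\<close> vertices, so the vertices of
  a part within a layer can be told apart by \<open>K\<^sub>m\<close>.

  The parts are built one at a time. Every component \<open>C\<close> of the uncovered vertices is attached to at
  most \<open>s\<close> earlier parts, which lie in pairwise adjacent disjoint connected branch sets outside \<open>C\<close>.
  Consider the connected subsets of \<open>C\<close> that touch all branch sets. If there are \<open>s\<close> branch sets, then
  \<open>t\<close> disjoint such subsets would give a \<open>K\<^sup>*\<^sub>s\<^sub>,\<^sub>t\<close> minor, so by the Helly property of subtrees \<open>t - 1\<close> bags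
  meet all of them. If there are fewer, one bag, restricted to one such subset \<open>D\<close>, separates \<open>D\<close>
  from the others, and \<open>D\<close> serves as an additional branch set. An inclusion-minimal set of this kind is
  the next part; a remaining component that misses some branch set is handled by enlarging that branch set.
\<close>

section \<open>Connected sets and components\<close>

text \<open>A cut condition instead of walks; for symmetric \<open>E\<close> it is equivalent to
  mutual reachability inside \<open>S\<close>, see \<open>rtrancl_on_iff_conn_set\<close>. The empty
  set satisfies it, so nonemptiness is stated separately where it matters.\<close>

definition conn_set :: "'a rel \<Rightarrow> 'a set \<Rightarrow> bool" where
  "conn_set E S \<longleftrightarrow> (\<forall>P. P \<subseteq> S \<longrightarrow> P \<noteq> {} \<longrightarrow> P \<noteq> S \<longrightarrow> (\<exists>u\<in>P. \<exists>v\<in>S - P. (u, v) \<in> E))"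

definition component :: "'a rel \<Rightarrow> 'a set \<Rightarrow> 'a set \<Rightarrow> bool" where
  "component E S C \<longleftrightarrow> C \<subseteq> S \<and> C \<noteq> {} \<and> conn_set E C \<and> (\<forall>u\<in>C. \<forall>v\<in>S - C. (u, v) \<notin> E)"

definition touches :: "'a rel \<Rightarrow> 'a set \<Rightarrow> 'a set \<Rightarrow> bool" where
  "touches E A B \<longleftrightarrow> (\<exists>u\<in>A. \<exists>v\<in>B. (u, v) \<in> E)"

lemma touches_sym: "sym E \<Longrightarrow> touches E A B \<longleftrightarrow> touches E B A"
  by (auto simp: touches_def dest: symD)

lemma touches_mono: "touches E A B \<Longrightarrow> A \<subseteq> A' \<Longrightarrow> B \<subseteq> B' \<Longrightarrow> touches E A' B'"
  by (auto simp: touches_def)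

lemma conn_set_singleton [simp]: "conn_set E {x}"
  by (auto simp: conn_set_def)

lemma conn_set_crossing:
  assumes "conn_set E S" "x \<in> S" "x \<in> P" "y \<in> S" "y \<notin> P"
  shows "\<exists>u v. u \<in> S \<and> u \<in> P \<and> v \<in> S \<and> v \<notin> P \<and> (u, v) \<in> E"
proof -
  have "S \<inter> P \<subseteq> S" "S \<inter> P \<noteq> {}" "S \<inter> P \<noteq> S" using assms by auto
  then obtain u v where "u \<in> S \<inter> P" "v \<in> S - S \<inter> P" "(u, v) \<in> E"
    using assms(1) unfolding conn_set_def by meson
  then show ?thesis by auto
qed

text \<open>Serves as an induction principle: a property that holds at one point of a connected set
  and passes along its edges holds throughout.\<close>

lemma conn_set_subset_side:
  assumes "conn_set E D" "x \<in> D" "x \<in> P" "\<And>u v. u \<in> D \<Longrightarrow> u \<in> P \<Longrightarrow> v \<in> D \<Longrightarrow> (u, v) \<in> E \<Longrightarrow> v \<in> P"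
  shows "D \<subseteq> P"
  using assms conn_set_crossing[of E D x P] by blast

text \<open>A side \<open>P\<close> without outgoing edges contains each of \<open>A\<close> and
  \<open>B\<close> as soon as it meets it. A common point, or an edge between them used in both
  directions, then forces both or neither.\<close>

lemma conn_set_Un:
  assumes "sym E" "conn_set E A" "conn_set E B" "A \<inter> B \<noteq> {} \<or> touches E A B"
  shows "conn_set E (A \<union> B)"
  unfolding conn_set_def
proof (intro allI impI)
  fix P assume P: "P \<subseteq> A \<union> B" "P \<noteq> {}" "P \<noteq> A \<union> B"
  show "\<exists>u\<in>P. \<exists>v\<in>A \<union> B - P. (u, v) \<in> E"
  proof (rule ccontr)
    assume "\<not> ?thesis"
    then have no: "\<And>u v. u \<in> P \<Longrightarrow> v \<in> A \<union> B \<Longrightarrow> (u, v) \<in> E \<Longrightarrow> v \<in> P" by blast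
    have sA: "A \<subseteq> P" if "A \<inter> P \<noteq> {}" 
      using conn_set_subset_side[OF assms(2), of _ P] no that by blast
    have sB: "B \<subseteq> P" if "B \<inter> P \<noteq> {}" 
      using conn_set_subset_side[OF assms(3), of _ P] no that by blast
    have "A \<inter> P \<noteq> {} \<longleftrightarrow> B \<inter> P \<noteq> {}"
    proof (cases "A \<inter> B = {}")
      case False then show ?thesis using sA sB by blast
    next
      case True
      then obtain u v where uv: "u \<in> A" "v \<in> B" "(u, v) \<in> E" "(v, u) \<in> E"
        using assms(1,4) unfolding touches_def by (meson symD)
      show ?thesis using sA sB no[of u v] no[of v u] uv by blast
    qed
    then show False using sA sB P by blast
  qed
qed

text \<open>Each point lies in a connected superset of \<open>A\<close>; two such supersets overlap
  in \<open>A\<close>, so every cut is crossed within their union. Meant for enlarging a branch set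
  by components that touch it.\<close>

lemma conn_set_Union_attached:
  assumes "sym E" "conn_set E A" "A \<noteq> {}"
    and "\<And>x. x \<in> S \<Longrightarrow> \<exists>D. x \<in> D \<and> D \<subseteq> S \<and> conn_set E D \<and> touches E D A"
  shows "conn_set E (A \<union> S)"
  unfolding conn_set_def
proof (intro allI impI)
  fix P assume P: "P \<subseteq> A \<union> S" "P \<noteq> {}" "P \<noteq> A \<union> S"
  obtain x where x: "x \<in> A \<union> S" "x \<notin> P" using P by blast
  obtain y where y: "y \<in> A \<union> S" "y \<in> P" using P by blast
  have reach: "\<exists>D. x \<in> D \<and> D \<subseteq> A \<union> S \<and> conn_set E D \<and> A \<subseteq> D" if xAS: "x \<in> A \<union> S" for x
  proof (cases "x \<in> A")
    case True then show ?thesis using assms(2) by blast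
  next
    case False
    then obtain D where "x \<in> D \<and> D \<subseteq> S \<and> conn_set E D \<and> touches E D A"
      using xAS assms(4)[of x] by auto
    then show ?thesis using conn_set_Un[OF assms(1), of D A] assms(2) by (intro exI[of _ "D \<union> A"]) auto
  qed
  obtain D1 D2 where D: "x \<in> D1" "D1 \<subseteq> A \<union> S" "conn_set E D1" "A \<subseteq> D1"
    "y \<in> D2" "D2 \<subseteq> A \<union> S" "conn_set E D2" "A \<subseteq> D2" using reach[OF x(1)] reach[OF y(1)] by metis
  have "conn_set E (D1 \<union> D2)"
    by (rule conn_set_Un) (use D assms in auto)
  then obtain u v where "u \<in> P" "v \<in> D1 \<union> D2" "v \<notin> P" "(u, v) \<in> E"
    using conn_set_crossing[of E "D1 \<union> D2" y P x] D x y by blast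
  then show "\<exists>u\<in>P. \<exists>v\<in>A \<union> S - P. (u, v) \<in> E" using D by blast
qed

text \<open>A maximal connected set between \<open>D\<close> and \<open>S\<close> is a component,
  since an edge leaving it inside \<open>S\<close> would enlarge it.\<close>

lemma component_exists:
  assumes "sym E" "finite S" "D \<subseteq> S" "D \<noteq> {}" "conn_set E D"
  obtains C where "component E S C" "D \<subseteq> C"
proof -
  let ?P = "\<lambda>C. D \<subseteq> C \<and> C \<subseteq> S \<and> conn_set E C"
  have "finite {C. ?P C}" using assms(2) by (rule_tac finite_subset[of _ "Pow S"]) auto
  moreover have "D \<in> {C. ?P C}" using assms by auto
  ultimately obtain C where C: "?P C" and mx: "\<And>C'. ?P C' \<Longrightarrow> C \<subseteq> C' \<Longrightarrow> C = C'"
    using finite_has_maximal[of "{C. ?P C}"] by (metis (mono_tags, lifting) empty_iff mem_Collect_eq)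
  have "(u, v) \<notin> E" if "u \<in> C" "v \<in> S - C" for u v
  proof
    assume "(u, v) \<in> E"
    then have "conn_set E (C \<union> {v})"
      using conn_set_Un[OF assms(1), of C "{v}"] C that by (auto simp: touches_def)
    then show False using mx[of "C \<union> {v}"] C that by auto
  qed
  then have "component E S C" using C assms unfolding component_def by auto
  then show ?thesis using that C by auto
qed

lemma component_of:
  assumes "sym E" "finite S" "x \<in> S"
  obtains C where "component E S C" "x \<in> C"
  using component_exists[OF assms(1,2), of "{x}"] assms(3) by auto

lemma component_absorbs:
  assumes "component E S C" "conn_set E D" "D \<subseteq> S" "D \<inter> C \<noteq> {}"
  shows "D \<subseteq> C"
  using conn_set_subset_side[OF assms(2), of _ C] assms unfolding component_def by blast

lemma component_disjoint_or_eq: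
  assumes "component E S C" "component E S C'"
  shows "C = C' \<or> C \<inter> C' = {}"
  using component_absorbs[OF assms(1), of C'] component_absorbs[OF assms(2), of C] assms
  unfolding component_def by blast

section \<open>Rooted trees of bags\<close>

text \<open>To be read as: \<open>k\<close> lies in the subtree rooted at \<open>i\<close>. The
  guard \<open>i < k\<close> gives \<open>i \<le> k\<close> without any assumption on
  \<open>par\<close>, and \<open>par 0\<close> is never consulted.\<close>

inductive descendant :: "(nat \<Rightarrow> nat) \<Rightarrow> nat \<Rightarrow> nat \<Rightarrow> bool" for par i where
  self: "descendant par i i"
| step: "i < k \<Longrightarrow> descendant par i (par k) \<Longrightarrow> descendant par i k"

lemma descendant_ge: "descendant par i k \<Longrightarrow> i \<le> k"
  by (induction rule: descendant.induct) auto

text \<open>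
  The vertex sets of subtrees, for trees whose nodes are numbered such that parents precede children.
\<close>
definition parent_closed :: "(nat \<Rightarrow> nat) \<Rightarrow> nat set \<Rightarrow> bool" where
  "parent_closed par A \<longleftrightarrow> (\<forall>a\<in>A. \<forall>b\<in>A. b < a \<longrightarrow> par a \<in> A)"

text \<open>The climb from \<open>k\<close> to \<open>i\<close> stays in \<open>A\<close>: a node
  above \<open>i\<close> in number also exceeds \<open>m\<close>, so parent-closure applies to it.
  In a tree, \<open>i\<close> lies on the path from \<open>k\<close> to \<open>m\<close>.\<close>

lemma parent_closed_contains:
  assumes "parent_closed par A" "descendant par i k" "k \<in> A" "m \<in> A" "m < i"
  shows "i \<in> A"
  using assms(2,3)
proof (induction rule: descendant.induct)
  case (step k)
  then have "par k \<in> A" using assms(1,4,5) unfolding parent_closed_def by auto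
  then show ?case using step by auto
qed

text \<open>The least element of \<open>A\<close> is the root of the subtree. Climbing from
  \<open>k\<close> reaches it without leaving the subtree rooted at \<open>i\<close>; every other
  member of \<open>A\<close> then inherits the property from its parent.\<close>

lemma parent_closed_descendants:
  assumes par: "\<And>i. 0 < i \<Longrightarrow> i \<in> A \<Longrightarrow> par i < i"
    and A: "parent_closed par A" "descendant par i k" "k \<in> A" "\<And>m. m \<in> A \<Longrightarrow> i \<le> m" "k' \<in> A"
  shows "descendant par i k'"
proof -
  define m where "m = (LEAST m. m \<in> A)"
  have m: "m \<in> A" "\<And>a. a \<in> A \<Longrightarrow> m \<le> a"
    unfolding m_def by (rule LeastI[of "\<lambda>m. m \<in> A", OF A(3)], rule Least_le)
  have "descendant par i m" using A(2,3)
  proof (induction rule: descendant.induct)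
    case self
    then have "m = i" using m(2)[of i] A(4)[OF m(1)] by simp
    then show ?case by (simp add: descendant.self)
  next
    case (step k)
    show ?case
    proof (cases "k = m")
      case True then show ?thesis using descendant.step[OF step.hyps] by simp
    next
      case False
      then have "m < k" using m(2)[OF step.prems] by simp
      then have "par k \<in> A" using A(1) m(1) step.prems unfolding parent_closed_def by blast
      then show ?thesis by (rule step.IH)
    qed
  qed
  then show ?thesis using A(5)
  proof (induction k' rule: less_induct)
    case (less k')
    show ?case
    proof (cases "k' = m")
      case False
      then have lt: "m < k'" using m(2)[OF less.prems(2)] by simp
      then have p: "par k' \<in> A" using A(1) m(1) less.prems(2) unfolding parent_closed_def by blast
      have "par k' < k'" using par[of k'] lt less.prems(2) by simp
      then have "descendant par i (par k')" using less.IH less.prems(1) p by blast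
      moreover have "i < k'" using lt A(4)[OF m(1)] by simp
      ultimately show ?thesis by (rule descendant.step[rotated])
    qed (use less in simp)
  qed
qed

text \<open>A tree-decomposition with numbered nodes, root 0 and parents before children;
  \<open>vertex_closed\<close> says that the bags of a vertex form a subtree. With this numbering
  the topmost node of a subtree is its minimum.\<close>

locale bag_tree =
  fixes V :: "'a set" and E :: "'a rel" and n :: nat and par :: "nat \<Rightarrow> nat" and W :: "nat \<Rightarrow> 'a set"
  assumes finite_V: "finite V"
    and sym_E: "sym E"
    and E_sub: "E \<subseteq> V \<times> V"
    and par_less: "0 < i \<Longrightarrow> i < n \<Longrightarrow> par i < i"
    and edge_bag: "(u, v) \<in> E \<Longrightarrow> \<exists>i<n. u \<in> W i \<and> v \<in> W i"
    and vertex_bag: "v \<in> V \<Longrightarrow> \<exists>i<n. v \<in> W i"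
    and vertex_closed: "v \<in> V \<Longrightarrow> parent_closed par {i. i < n \<and> v \<in> W i}"
begin

section \<open>Subtrees met by connected vertex sets, and the Helly property\<close>

definition nodes :: "'a set \<Rightarrow> nat set" where
  "nodes D = {i. i < n \<and> D \<inter> W i \<noteq> {}}"

lemma finite_nodes [simp]: "finite (nodes D)"
  by (auto simp: nodes_def)

lemma nodes_nonempty: "D \<subseteq> V \<Longrightarrow> D \<noteq> {} \<Longrightarrow> nodes D \<noteq> {}"
  using vertex_bag unfolding nodes_def by fast

text \<open>An occurrence of \<open>v\<close> at a number smaller than \<open>i\<close> would force
  \<open>i\<close> into the subtree of \<open>v\<close>. Hence this subtree starts at or after
  \<open>i\<close> and stays among the descendants of \<open>i\<close>.\<close>

lemma bags_below_missing_node: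
  assumes "v \<in> V" "i < n" "k < n" "v \<in> W k" "descendant par i k" "v \<notin> W i"
    and "k' < n" "v \<in> W k'"
  shows "descendant par i k'"
proof (rule parent_closed_descendants[OF _ vertex_closed[OF assms(1)] assms(5)])
  fix m assume "m \<in> {i. i < n \<and> v \<in> W i}"
  then show "i \<le> m"
    using parent_closed_contains[OF vertex_closed[OF assms(1)] assms(5), of m] assms by force
qed (use assms par_less in auto)

text \<open>If \<open>par i\<close> were missed, no vertex of \<open>D\<close> could have bags both
  inside and outside the subtree rooted at \<open>i\<close>. As adjacent vertices share a bag, all
  of \<open>D\<close> would stay inside, although it also has the smaller node
  \<open>j\<close>.\<close>

lemma nodes_parent_closed:
  assumes D: "D \<subseteq> V" "conn_set E D"
  shows "parent_closed par (nodes D)"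
  unfolding parent_closed_def
proof (intro ballI impI, rule ccontr)
  fix i j assume i: "i \<in> nodes D" and j: "j \<in> nodes D" "j < i" and np: "par i \<notin> nodes D"
  have in_: "i < n" "par i < n" using i j par_less[of i] by (auto simp: nodes_def)
  define P where "P = {v. \<exists>k<n. v \<in> W k \<and> descendant par i k}"
  have all: "descendant par i k'" if v: "v \<in> D" "v \<in> P" "k' < n" "v \<in> W k'" for v k'
  proof -
    obtain k where k: "k < n" "v \<in> W k" "descendant par i k" using v unfolding P_def by auto
    have vV: "v \<in> V" using v D by auto
    have pc: "parent_closed par {i. i < n \<and> v \<in> W i}" using vertex_closed[OF vV] .
    have ge: "i \<le> m" if "m < n" "v \<in> W m" for m
    proof (rule ccontr)
      assume "\<not> i \<le> m"
      then have "i \<in> {i. i < n \<and> v \<in> W i}" using parent_closed_contains[OF pc k(3), of m] k that by auto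
      then have "v \<in> W (par i)" using pc that \<open>\<not> i \<le> m\<close> unfolding parent_closed_def by (metis (mono_tags, lifting) mem_Collect_eq not_le)
      then show False using np v(1) in_ unfolding nodes_def by auto
    qed
    show ?thesis
      by (rule parent_closed_descendants[OF _ pc k(3)]) (use k ge v par_less in auto)
  qed
  obtain x where x: "x \<in> D" "x \<in> P" 
    using i descendant.self[of par i] unfolding nodes_def P_def by blast
  have "D \<subseteq> P"
  proof (rule conn_set_subset_side[OF D(2) x])
    fix u v assume uv: "u \<in> D" "u \<in> P" "v \<in> D" "(u, v) \<in> E"
    obtain k where "k < n" "u \<in> W k" "v \<in> W k" using edge_bag uv by blast
    then show "v \<in> P" using all[OF uv(1,2)] unfolding P_def by auto
  qed
  moreover obtain y where "y \<in> D" "y \<in> W j" using j unfolding nodes_def by auto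
  ultimately have "descendant par i j" using all j unfolding nodes_def by blast
  then show False using descendant_ge j by fastforce
qed

text \<open>The extremal choice behind both of the following lemmas: among the topmost nodes of the
  members, take the one with the largest number.\<close>

lemma lowest_member:
  assumes "F \<noteq> {}" "\<And>D. D \<in> F \<Longrightarrow> D \<subseteq> V \<and> D \<noteq> {} \<and> conn_set E D"
  obtains D z where "D \<in> F" "z \<in> nodes D" "\<And>i. i \<in> nodes D \<Longrightarrow> z \<le> i"
    "\<And>D'. D' \<in> F \<Longrightarrow> \<exists>i\<in>nodes D'. i \<le> z"
proof -
  have ne: "nodes D \<noteq> {}" if "D \<in> F" for D using assms(2)[OF that] nodes_nonempty by auto
  let ?M = "(\<lambda>D. Min (nodes D)) ` F"
  have "?M \<subseteq> {..<n}" using ne Min_in[OF finite_nodes] unfolding nodes_def by blast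
  then have fin: "finite ?M" using finite_subset by auto
  then have "Max ?M \<in> ?M" using assms(1) by (intro Max_in) auto
  then obtain D where D: "D \<in> F" "Max ?M = Min (nodes D)" by auto
  show ?thesis
  proof (rule that[of D "Min (nodes D)"])
    fix D' assume "D' \<in> F"
    then have "Min (nodes D') \<le> Max ?M" "Min (nodes D') \<in> nodes D'"
      using fin ne Min_in[OF finite_nodes] by auto
    then show "\<exists>i\<in>nodes D'. i \<le> Min (nodes D)" using D by auto
  qed (use D ne in auto)
qed

text \<open>Greedy packing and covering of subtrees: if \<open>D\<close> is the member whose topmost
  node \<open>z\<close> comes last, every member meeting \<open>D\<close> meets bag
  \<open>z\<close>. By induction on the members avoiding bag \<open>z\<close>, either
  \<open>D\<close> extends a disjoint family or \<open>z\<close> extends a hitting set.\<close>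

lemma hitting_bags_or_disjoint:
  assumes "\<And>D. D \<in> F \<Longrightarrow> D \<subseteq> V \<and> D \<noteq> {} \<and> conn_set E D"
  shows "(\<exists>\<D>\<subseteq>F. finite \<D> \<and> card \<D> = Suc q \<and> disjoint \<D>) \<or>
         (\<exists>Z\<subseteq>{..<n}. card Z \<le> q \<and> (\<forall>D\<in>F. D \<inter> (\<Union>z\<in>Z. W z) \<noteq> {}))"
  using assms
proof (induction q arbitrary: F)
  case 0
  show ?case
  proof (cases "F = {}")
    case False
    then obtain D where "D \<in> F" by auto
    then have "{D} \<subseteq> F \<and> finite {D} \<and> card {D} = Suc 0 \<and> disjoint {D}" by auto
    then show ?thesis by blast
  qed auto
next
  case (Suc q)
  show ?case
  proof (cases "F = {}")
    case False
    then obtain D z where D: "D \<in> F" "z \<in> nodes D" "\<And>i. i \<in> nodes D \<Longrightarrow> z \<le> i"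
      "\<And>D'. D' \<in> F \<Longrightarrow> \<exists>i\<in>nodes D'. i \<le> z" using lowest_member Suc.prems by metis
    have zn: "z < n" using D unfolding nodes_def by auto
    have DV: "D \<subseteq> V" "D \<noteq> {}" "conn_set E D" using Suc.prems D by auto
    let ?F = "{D' \<in> F. D' \<inter> W z = {}}"
    \<comment> \<open>A common vertex gives \<open>D'\<close> a node in the subtree rooted at
      \<open>z\<close>; it also has a node numbered at most \<open>z\<close>, so it must meet bag
      \<open>z\<close>.\<close>
    have disj: "D' \<inter> D = {}" if D': "D' \<in> ?F" for D'
    proof (rule ccontr)
      assume "D' \<inter> D \<noteq> {}"
      then obtain v where v: "v \<in> D" "v \<in> D'" by auto
      then obtain b where b: "b < n" "v \<in> W b" using vertex_bag DV by auto
      then have bb: "b \<in> nodes D" "b \<in> nodes D'" using v unfolding nodes_def by auto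
      have D'V: "D' \<subseteq> V" "conn_set E D'" using Suc.prems D' by auto
      have desc: "descendant par z b"
        by (rule parent_closed_descendants[OF _ nodes_parent_closed[OF DV(1,3)] descendant.self])
          (use D bb par_less in \<open>auto simp: nodes_def\<close>)
      obtain m where m: "m \<in> nodes D'" "m \<le> z" using D(4) D' by auto
      have "z \<in> nodes D'"
        using parent_closed_contains[OF nodes_parent_closed[OF D'V] desc bb(2) m(1)] m 
        by (cases "m = z") auto
      then show False using D' unfolding nodes_def by auto
    qed
    have "(\<exists>\<D>\<subseteq>?F. finite \<D> \<and> card \<D> = Suc q \<and> disjoint \<D>) \<or>
        (\<exists>Z\<subseteq>{..<n}. card Z \<le> q \<and> (\<forall>D\<in>?F. D \<inter> (\<Union>z\<in>Z. W z) \<noteq> {}))"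
      by (rule Suc.IH) (use Suc.prems in simp)
    then show ?thesis
    proof (elim disjE exE conjE)
      fix \<D> assume 1: "\<D> \<subseteq> ?F" "finite \<D>" "card \<D> = Suc q" "disjoint \<D>"
      have "D \<notin> \<D>" using disj 1(1) DV by blast
      moreover have "disjoint (insert D \<D>)" using 1 disj by (intro pairwise_insert[THEN iffD2])
          (auto simp: disjnt_def)
      ultimately have "insert D \<D> \<subseteq> F \<and> finite (insert D \<D>) \<and> card (insert D \<D>) = Suc (Suc q) \<and> disjoint (insert D \<D>)"
        using 1 D by auto
      then show ?thesis by blast
    next
      fix Z assume 2: "Z \<subseteq> {..<n}" "card Z \<le> q" "\<forall>D\<in>?F. D \<inter> (\<Union>z\<in>Z. W z) \<noteq> {}"
      have "insert z Z \<subseteq> {..<n}" "card (insert z Z) \<le> Suc q"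
        using 2(1,2) zn card_insert_le_m1[of "Suc q" Z z] by auto
      moreover have "\<forall>D\<in>F. D \<inter> (\<Union>z\<in>insert z Z. W z) \<noteq> {}" using 2(3) by auto
      ultimately show ?thesis by blast
    qed
  qed auto
qed

text \<open>Let \<open>D0\<close> be the member whose topmost node \<open>z\<close> comes last, and
  enlarge it to a component \<open>D\<close> of the vertices of \<open>C\<close> with a bag in the
  subtree rooted at \<open>z\<close>. Outside bag \<open>z\<close>, no edge within \<open>C\<close>
  leaves \<open>D\<close>, so a remaining component meeting \<open>D\<close> lies strictly below
  \<open>z\<close> and cannot belong to \<open>F\<close>.\<close>

lemma separating_bag:
  assumes C: "C \<subseteq> V" 
    and F: "F \<noteq> {}" "\<And>D. D \<in> F \<Longrightarrow> D \<subseteq> C \<and> D \<noteq> {} \<and> conn_set E D"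
    and up: "\<And>D D'. D \<in> F \<Longrightarrow> D \<subseteq> D' \<Longrightarrow> D' \<subseteq> C \<Longrightarrow> conn_set E D' \<Longrightarrow> D' \<in> F"
  obtains D z where "D \<in> F" "z < n"
    "\<And>C'. component E (C - D \<inter> W z) C' \<Longrightarrow> C' \<in> F \<Longrightarrow> C' \<inter> D = {}"
proof -
  have FV: "D \<subseteq> V \<and> D \<noteq> {} \<and> conn_set E D" if "D \<in> F" for D using F(2)[OF that] C by auto
  obtain D0 z where D0: "D0 \<in> F" "z \<in> nodes D0" "\<And>i. i \<in> nodes D0 \<Longrightarrow> z \<le> i"
      "\<And>D'. D' \<in> F \<Longrightarrow> \<exists>i\<in>nodes D'. i \<le> z" 
    using lowest_member[OF F(1) FV] by metis
  have zn: "z < n" using D0 unfolding nodes_def by auto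
  define S where "S = {v \<in> C. \<exists>k<n. v \<in> W k \<and> descendant par z k}"
  have D0V: "D0 \<subseteq> V" "conn_set E D0" "D0 \<noteq> {}" using FV[OF D0(1)] by auto
  have D0S: "D0 \<subseteq> S"
  proof
    fix v assume v: "v \<in> D0"
    then obtain b where b: "b < n" "v \<in> W b" using vertex_bag D0V by auto
    then have "b \<in> nodes D0" using v unfolding nodes_def by auto
    then have "descendant par z b"
      by (intro parent_closed_descendants[OF _ nodes_parent_closed[OF D0V(1,2)] descendant.self])
        (use D0 par_less in \<open>auto simp: nodes_def\<close>)
    then show "v \<in> S" using b v D0 F unfolding S_def by blast
  qed
  have "S \<subseteq> V" using C unfolding S_def by auto
  then have "finite S" using finite_V finite_subset by auto
  then obtain D where D: "component E S D" "D0 \<subseteq> D"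
    using component_exists[OF sym_E _ D0S D0V(3,2)] by auto
  \<comment> \<open>A vertex of \<open>S\<close> outside bag \<open>z\<close> has all its bags
    strictly below \<open>z\<close>, so its neighbours in \<open>C\<close> are in \<open>S\<close>
    as well.\<close>
  have low: "descendant par z k \<and> z < k" if "v \<in> S" "v \<notin> W z" "k < n" "v \<in> W k" for v k
  proof -
    have "descendant par z k" using bags_below_missing_node[of v z] that zn C unfolding S_def by blast
    then show ?thesis using descendant_ge[of par z k] that by (cases "k = z") auto
  qed
  show ?thesis
  proof (rule that[of D z])
    show "D \<in> F" using up[OF D0(1), of D] D unfolding component_def S_def by blast
    fix C' assume C': "component E (C - D \<inter> W z) C'" "C' \<in> F"
    show "C' \<inter> D = {}"
    proof (rule ccontr)
      assume "C' \<inter> D \<noteq> {}"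
      then obtain x where x: "x \<in> C'" "x \<in> D" by auto
      have con: "conn_set E C'" using C' unfolding component_def by auto
      have "C' \<subseteq> D"
      proof (rule conn_set_subset_side[OF con x])
        fix u v assume uv: "u \<in> C'" "u \<in> D" "v \<in> C'" "(u, v) \<in> E"
        then have u: "u \<in> S" "u \<notin> W z" using C' D unfolding component_def by auto
        obtain k where k: "k < n" "u \<in> W k" "v \<in> W k" using edge_bag uv by blast
        have "v \<in> S" using low[OF u k(1,2)] k uv(3) C' unfolding S_def component_def by auto
        then show "v \<in> D" using uv D unfolding component_def by auto
      qed
      \<comment> \<open>Membership in \<open>F\<close> forces a node numbered at most
        \<open>z\<close>, whereas \<open>C'\<close> lies in \<open>D\<close> and avoids bag
        \<open>z\<close>.\<close>
      obtain i where i: "i \<in> nodes C'" "i \<le> z" using D0(4) C' by auto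
      then obtain v where v: "v \<in> C'" "v \<in> W i" "i < n" unfolding nodes_def by auto
      then have "v \<in> S" "v \<notin> W z" using C' D \<open>C' \<subseteq> D\<close> unfolding component_def by auto
      then show False using low[of v i] v i by auto
    qed
  qed (rule zn)
qed

end

section \<open>Partitions into parts covered by few bags\<close>

text \<open>The branch sets of a minor, stated for a vertex set and a relation so that it can be
  used inside \<open>bag_tree\<close>; \<open>minor_model_is_minor\<close> leads back to
  contractions.\<close>

definition minor_model :: "'b pair_pre_digraph \<Rightarrow> 'a set \<Rightarrow> 'a rel \<Rightarrow> ('b \<Rightarrow> 'a set) \<Rightarrow> bool" where
  "minor_model X V E M \<longleftrightarrow>
     (\<forall>i\<in>pverts X. M i \<subseteq> V \<and> M i \<noteq> {} \<and> conn_set E (M i)) \<and>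
     disjoint_family_on M (pverts X) \<and>
     (\<forall>(i, j)\<in>parcs X. touches E (M i) (M j))"

lemma K_star_simps [simp]:
  "pverts (K_star s t) = {..<s + t}"
  "parcs (K_star s t) =
     {(u, v). u < s \<and> v < s \<and> u \<noteq> v} \<union> {..<s} \<times> {s..<s + t} \<union> {s..<s + t} \<times> {..<s}"
  by (auto simp: K_star_def Let_def)

text \<open>The sets \<open>B r\<close> become the clique and the members of \<open>\<D>\<close> the
  independent set; the latter are numbered from \<open>s\<close> on, as in
  \<open>K_star\<close>.\<close>

lemma K_star_model:
  assumes "sym E" "finite Q" "card Q = s" "finite \<D>" "card \<D> = t" "disjoint \<D>"
    and B: "\<And>r. r \<in> Q \<Longrightarrow> B r \<subseteq> V \<and> B r \<noteq> {} \<and> conn_set E (B r)"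
      "\<And>r q. r \<in> Q \<Longrightarrow> q \<in> Q \<Longrightarrow> r \<noteq> q \<Longrightarrow> B r \<inter> B q = {} \<and> touches E (B r) (B q)"
    and D: "\<And>D. D \<in> \<D> \<Longrightarrow> D \<subseteq> V \<and> D \<noteq> {} \<and> conn_set E D"
      "\<And>D r. D \<in> \<D> \<Longrightarrow> r \<in> Q \<Longrightarrow> D \<inter> B r = {} \<and> touches E D (B r)"
  shows "\<exists>M. minor_model (K_star s t) V E M"
proof -
  obtain g where g: "bij_betw g {..<s} Q"
    using ex_bij_betw_nat_finite[OF assms(2)] assms(3) by (auto simp: atLeast0LessThan)
  obtain h where h: "bij_betw h {..<t} \<D>"
    using ex_bij_betw_nat_finite[OF assms(4)] assms(5) by (auto simp: atLeast0LessThan)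
  define M where "M = (\<lambda>i. if i < s then B (g i) else h (i - s))"
  have gQ: "g i \<in> Q" if "i < s" for i using g that by (auto simp: bij_betw_def)
  have hD: "h (i - s) \<in> \<D>" if "s \<le> i" "i < s + t" for i
    using h that by (auto simp: bij_betw_def)
  have gne: "g i \<noteq> g j" if "i < s" "j < s" "i \<noteq> j" for i j
    using g that by (auto simp: bij_betw_def inj_on_def)
  have hdisj: "h (i - s) \<inter> h (j - s) = {}" if "s \<le> i" "s \<le> j" "i < s + t" "j < s + t" "i \<noteq> j" for i j
  proof -
    have "i - s \<noteq> j - s" "i - s < t" "j - s < t" using that by auto
    then have "h (i - s) \<noteq> h (j - s)" using h by (auto simp: bij_betw_def inj_on_def)
    then show ?thesis using hD assms(6) that by (auto simp: pairwise_def disjnt_def)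
  qed
  have "minor_model (K_star s t) V E M"
    unfolding minor_model_def
  proof (intro conjI)
    show "\<forall>i\<in>pverts (K_star s t). M i \<subseteq> V \<and> M i \<noteq> {} \<and> conn_set E (M i)"
      using B(1)[OF gQ] D(1)[OF hD] by (auto simp: M_def)
    show "disjoint_family_on M (pverts (K_star s t))"
      unfolding disjoint_family_on_def
    proof (intro ballI impI)
      fix i j assume "i \<in> pverts (K_star s t)" "j \<in> pverts (K_star s t)" "i \<noteq> j"
      then have "i < s + t" "j < s + t" "i \<noteq> j" by auto
      then show "M i \<inter> M j = {}"
        using B(2)[OF gQ gQ gne] D(2)[OF hD gQ] hdisj unfolding M_def
        by (cases "i < s"; cases "j < s") (auto simp: Int_commute)
    qed
    show "\<forall>(i, j)\<in>parcs (K_star s t). touches E (M i) (M j)"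
      using B(2)[OF gQ gQ gne] D(2)[OF hD gQ] touches_sym[OF assms(1)]
      by (auto simp: M_def)
  qed
  then show ?thesis by blast
qed

section \<open>Greedy construction of the partition\<close>

context bag_tree
begin

text \<open>The state of an uncovered component \<open>C\<close>: \<open>Q\<close> names earlier
  parts, and contracting \<open>C\<close> and the sets \<open>B r\<close> gives a clique.
  \<open>B r\<close> contains the neighbours of \<open>C\<close> in part \<open>r\<close>, but may
  differ from that part elsewhere.\<close>

definition branch_sets :: "('a \<Rightarrow> nat) \<Rightarrow> 'a set \<Rightarrow> nat set \<Rightarrow> (nat \<Rightarrow> 'a set) \<Rightarrow> bool" where
  "branch_sets f C Q B \<longleftrightarrow>
     finite Q \<and>
     (\<forall>r\<in>Q. B r \<subseteq> V \<and> B r \<noteq> {} \<and> conn_set E (B r) \<and> B r \<inter> C = {} \<and> touches E C (B r)) \<and>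
     (\<forall>r\<in>Q. \<forall>q\<in>Q. r \<noteq> q \<longrightarrow> B r \<inter> B q = {} \<and> touches E (B r) (B q)) \<and>
     (\<forall>c\<in>C. \<forall>y. (c, y) \<in> E \<longrightarrow> y \<notin> C \<longrightarrow> f y \<in> Q \<and> y \<in> B (f y))"

definition covered :: "nat \<Rightarrow> 'a set \<Rightarrow> bool" where
  "covered q X \<longleftrightarrow> (\<exists>Z\<subseteq>{..<n}. card Z \<le> q \<and> X \<subseteq> (\<Union>z\<in>Z. W z))"

lemma covered_subset: "covered q X \<Longrightarrow> Y \<subseteq> X \<Longrightarrow> covered q Y"
  unfolding covered_def by (meson order.trans)

text \<open>
  In the second alternative the connectedness comes from the minimality of \<open>X\<close>: a component \<open>K\<close> of
  \<open>C - C'\<close> not touching \<open>B r\<close> could be removed from \<open>X\<close>.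
\<close>
lemma next_part:
  assumes C: "C \<subseteq> V" "C \<noteq> {}" "conn_set E C"
    and B: "branch_sets f C Q B" "card Q \<le> s"
    and t: "2 \<le> t" and free: "\<nexists>M. minor_model (K_star s t) V E M"
  obtains X where "X \<subseteq> C" "X \<noteq> {}" "covered (t - 1) X"
    "\<forall>C'. component E (C - X) C' \<longrightarrow>
       card Q < s \<and> (\<forall>r\<in>Q. touches E C' (B r)) \<and>
       (\<exists>D. X \<subseteq> D \<and> D \<subseteq> C \<and> conn_set E D \<and> D \<inter> C' = {} \<and> (\<forall>r\<in>Q. touches E D (B r)))
       \<or> (\<exists>r\<in>Q. \<not> touches E C' (B r) \<and> conn_set E (B r \<union> (C - C')))"
proof -
  define F where "F = {D. D \<subseteq> C \<and> D \<noteq> {} \<and> conn_set E D \<and> (\<forall>r\<in>Q. touches E D (B r))}"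
  \<comment> \<open>Only remaining components that touch every branch set are constrained: for
    these, \<open>D\<close> will be an additional branch set, for which \<open>card Q < s\<close>
    leaves room.\<close>
  define good where "good X \<longleftrightarrow> X \<subseteq> C \<and> (\<forall>C'. component E (C - X) C' \<longrightarrow> C' \<in> F \<longrightarrow>
      card Q < s \<and> (\<exists>D\<in>F. X \<subseteq> D \<and> D \<inter> C' = {}))" for X
  have finC: "finite C" using C finite_V finite_subset by auto
  have CF: "C \<in> F" using C B unfolding F_def branch_sets_def by auto
  have FV: "D \<subseteq> V \<and> D \<noteq> {} \<and> conn_set E D" if "D \<in> F" for D using that C unfolding F_def by auto
  have ex: "\<exists>X. good X \<and> covered (t - 1) X"
  proof (cases "card Q < s")
    case True
    \<comment> \<open>With room for another branch set a single bag suffices, since \<open>F\<close>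
      is closed under connected enlargement within \<open>C\<close>.\<close>
    obtain D z where D: "D \<in> F" "z < n"
      "\<And>C'. component E (C - D \<inter> W z) C' \<Longrightarrow> C' \<in> F \<Longrightarrow> C' \<inter> D = {}"
    proof (rule separating_bag[OF C(1), of F])
      fix D D' assume "D \<in> F" "D \<subseteq> D'" "D' \<subseteq> C" "conn_set E D'"
      then show "D' \<in> F" unfolding F_def using touches_mono[of E D _ D'] by blast
    qed (use CF in \<open>auto simp: F_def\<close>)
    have "good (D \<inter> W z)" unfolding good_def
    proof (intro conjI allI impI)
      show "D \<inter> W z \<subseteq> C" using D unfolding F_def by auto
      fix C' assume "component E (C - D \<inter> W z) C'" "C' \<in> F"
      then have "D \<inter> C' = {}" using D(3) by auto
      then show "\<exists>D'\<in>F. D \<inter> W z \<subseteq> D' \<and> D' \<inter> C' = {}" using D by auto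
    qed (rule True)
    moreover have "covered (t - 1) (D \<inter> W z)"
      unfolding covered_def by (rule exI[of _ "{z}"]) (use D t in auto)
    ultimately show ?thesis by blast
  next
    case False
    then have cQ: "card Q = s" using B by auto
    \<comment> \<open>With \<open>s\<close> branch sets, \<open>t\<close> disjoint members of
      \<open>F\<close> would complete a \<open>K_star s t\<close> model.\<close>
    have nd: "\<not> (\<exists>\<D>\<subseteq>F. finite \<D> \<and> card \<D> = Suc (t - 1) \<and> disjoint \<D>)"
    proof
      assume "\<exists>\<D>\<subseteq>F. finite \<D> \<and> card \<D> = Suc (t - 1) \<and> disjoint \<D>"
      then obtain \<D> where DD: "\<D> \<subseteq> F" "finite \<D>" "card \<D> = t" "disjoint \<D>" using t by auto
      have "\<exists>M. minor_model (K_star s t) V E M"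
      proof (rule K_star_model[OF sym_E _ cQ DD(2-4), where B = B])
        fix D r assume "D \<in> \<D>" "r \<in> Q"
        then show "D \<inter> B r = {} \<and> touches E D (B r)" 
          using DD(1) B unfolding F_def branch_sets_def by blast
      qed (use B FV DD(1) in \<open>auto simp: branch_sets_def\<close>)
      then show False using free by blast
    qed
    have "(\<exists>\<D>\<subseteq>F. finite \<D> \<and> card \<D> = Suc (t - 1) \<and> disjoint \<D>) \<or>
         (\<exists>Z\<subseteq>{..<n}. card Z \<le> t - 1 \<and> (\<forall>D\<in>F. D \<inter> (\<Union>z\<in>Z. W z) \<noteq> {}))"
      by (rule hitting_bags_or_disjoint[OF FV])
    with nd obtain Z where Z: "Z \<subseteq> {..<n}" "card Z \<le> t - 1" "\<forall>D\<in>F. D \<inter> (\<Union>z\<in>Z. W z) \<noteq> {}"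
      by auto
    \<comment> \<open>Every member of \<open>F\<close> meets one of the bags in \<open>Z\<close>, so
      no remaining component is a member and \<open>good\<close> holds vacuously.\<close>
    have "C' \<notin> F" if "component E (C - C \<inter> (\<Union>z\<in>Z. W z)) C'" for C'
      using Z(3) that unfolding component_def by auto
    then have "good (C \<inter> (\<Union>z\<in>Z. W z))" unfolding good_def by auto
    moreover have "covered (t - 1) (C \<inter> (\<Union>z\<in>Z. W z))" using Z unfolding covered_def by blast
    ultimately show ?thesis by blast
  qed
  then obtain X0 where X0: "good X0" "covered (t - 1) X0" by auto
  \<comment> \<open>A minimal good set is chosen below \<open>X0\<close>, so it stays covered by the
    same bags.\<close>
  let ?G = "{X. X \<subseteq> X0 \<and> good X}"
  have "?G \<subseteq> Pow C" unfolding good_def by auto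
  then have "finite ?G" using finC finite_subset by auto
  moreover have "X0 \<in> ?G" using X0 by auto
  ultimately obtain X where "X \<in> ?G" and m: "\<forall>X'\<in>?G. X' \<subseteq> X \<longrightarrow> X = X'"
    using finite_has_minimal[of ?G] by blast
  then have X: "X \<subseteq> X0" "good X" by auto
  have min: "\<not> good X'" if "X' \<subset> X" for X' using m that X by auto
  have XC: "X \<subseteq> C" using X unfolding good_def by auto
  \<comment> \<open>Otherwise \<open>C\<close> itself would remain and belong to \<open>F\<close>,
    but no member of \<open>F\<close> is disjoint from \<open>C\<close>.\<close>
  have "X \<noteq> {}"
  proof
    assume "X = {}"
    moreover have "component E C C" using C unfolding component_def by auto
    ultimately have "\<exists>D\<in>F. D \<inter> C = {}" using X CF unfolding good_def by auto
    then show False unfolding F_def by auto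
  qed
  show ?thesis
  proof (rule that[OF XC \<open>X \<noteq> {}\<close> covered_subset[OF X0(2) X(1)]], intro allI impI)
    fix C' assume C': "component E (C - X) C'"
    have c': "C' \<subseteq> C" "C' \<noteq> {}" "conn_set E C'" "C' \<inter> X = {}" using C' unfolding component_def by auto
    show "card Q < s \<and> (\<forall>r\<in>Q. touches E C' (B r)) \<and>
       (\<exists>D. X \<subseteq> D \<and> D \<subseteq> C \<and> conn_set E D \<and> D \<inter> C' = {} \<and> (\<forall>r\<in>Q. touches E D (B r)))
       \<or> (\<exists>r\<in>Q. \<not> touches E C' (B r) \<and> conn_set E (B r \<union> (C - C')))"
    proof (cases "C' \<in> F")
      case True
      then show ?thesis using X(2) C' unfolding good_def F_def by blast
    next
      case False
      then obtain r where r: "r \<in> Q" "\<not> touches E C' (B r)" using c' unfolding F_def by auto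
      have Br: "B r \<noteq> {}" "conn_set E (B r)" using r B unfolding branch_sets_def by auto
      have "conn_set E (B r \<union> (C - C'))"
      proof (rule conn_set_Union_attached[OF sym_E Br(2,1)])
        fix x assume x: "x \<in> C - C'"
        obtain K where K: "component E (C - C') K" "x \<in> K"
          using component_of[OF sym_E _ x] finC by auto
        have k: "K \<subseteq> C" "K \<inter> C' = {}" "conn_set E K" using K unfolding component_def by auto
        have "touches E K (B r)"
        proof (rule ccontr)
          assume nt: "\<not> touches E K (B r)"
          obtain c where "c \<in> C'" using c' by auto
          \<comment> \<open>An edge of \<open>C\<close> leaving \<open>K\<close> must end in
            \<open>C'\<close>, and since \<open>C'\<close> is a component of \<open>C - X\<close> it
            starts in \<open>X\<close>. Thus \<open>X - K\<close> is strictly smaller than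
            \<open>X\<close>.\<close>
          then obtain u v where uv: "u \<in> K" "v \<in> C" "v \<notin> K" "(u, v) \<in> E"
            using conn_set_crossing[OF C(3), of x K c] K(2) k c' by blast
          have vC': "v \<in> C'" using uv K unfolding component_def by auto
          have "(v, u) \<in> E" using uv(4) sym_E by (simp add: symD)
          then have uX: "u \<in> X" using uv(1) vC' C' k unfolding component_def by blast
          have conU: "conn_set E (C' \<union> K)"
            using conn_set_Un[OF sym_E k(3) c'(3)] uv vC' by (auto simp: touches_def Un_commute)
          \<comment> \<open>Giving up \<open>X \<inter> K\<close> merges \<open>K\<close> with
            \<open>C'\<close> into one component, which misses \<open>B r\<close> and so is not in
            \<open>F\<close>. The other components are those of \<open>C - X\<close>, so
            \<open>X - K\<close> is still good.\<close>
          have U: "component E (C - (X - K)) (C' \<union> K)"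
            using conU C' K k c' unfolding component_def by auto
          have "good (X - K)" unfolding good_def
          proof (intro conjI allI impI)
            show "X - K \<subseteq> C" using XC by auto
            fix C'' assume C'': "component E (C - (X - K)) C''" "C'' \<in> F"
            have "C'' \<noteq> C' \<union> K"
              using C''(2) nt r unfolding F_def touches_def by blast
            then have dis: "C'' \<inter> (C' \<union> K) = {}" using component_disjoint_or_eq[OF C''(1) U] by auto
            have "component E (C - X) C''" using C''(1) dis unfolding component_def by blast
            then have "card Q < s \<and> (\<exists>D\<in>F. X \<subseteq> D \<and> D \<inter> C'' = {})" using X(2) C''(2) unfolding good_def by blast
            then show "card Q < s" "\<exists>D\<in>F. X - K \<subseteq> D \<and> D \<inter> C'' = {}" by auto
          qed
          then show False using min[of "X - K"] uX uv by blast
        qed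
        then show "\<exists>D. x \<in> D \<and> D \<subseteq> C - C' \<and> conn_set E D \<and> touches E D (B r)" using K k by blast
      qed
      then show ?thesis using r by blast
    qed
  qed
qed

text \<open>
  The set \<open>A\<close> is already partitioned by \<open>f\<close>, and \<open>R i\<close> contains the earlier neighbours of part \<open>i\<close>; the
  condition \<open>R i \<subseteq> insert p (R p)\<close> makes the sets \<open>insert i (R i)\<close> the bags of a tree-decomposition of
  the quotient.
\<close>
definition partial_partition ::
    "nat \<Rightarrow> nat \<Rightarrow> 'a set \<Rightarrow> nat \<Rightarrow> ('a \<Rightarrow> nat) \<Rightarrow> (nat \<Rightarrow> nat set) \<Rightarrow> bool" where
  "partial_partition s q A k f R \<longleftrightarrow>
     A \<subseteq> V \<and> 0 < k \<and> (\<forall>v\<in>A. f v < k) \<and>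
     (\<forall>i<k. R i \<subseteq> {..<i} \<and> card (R i) \<le> s \<and> (0 < i \<longrightarrow> (\<exists>p<i. R i \<subseteq> insert p (R p)))) \<and>
     (\<forall>u\<in>A. \<forall>v\<in>A. (u, v) \<in> E \<longrightarrow> f u = f v \<or> f u \<in> R (f v) \<or> f v \<in> R (f u)) \<and>
     (\<forall>i<k. covered q {v \<in> A. f v = i}) \<and>
     (\<forall>C. component E (V - A) C \<longrightarrow>
        (\<exists>p<k. \<exists>Q B. Q \<subseteq> insert p (R p) \<and> card Q \<le> s \<and> branch_sets f C Q B))"

text \<open>An empty part 0 makes a node \<open>p\<close> available from the start; components of
  \<open>V\<close> have no outside neighbours, so \<open>Q = {}\<close> serves them.\<close>

lemma partial_partition_empty: "partial_partition s q {} 1 f (\<lambda>_. {})"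
proof -
  have "branch_sets f C {} B" if "component E V C" for C B
    using that E_sub unfolding branch_sets_def component_def by auto
  moreover have "covered q {}" unfolding covered_def by (rule exI[of _ "{}"]) auto
  ultimately show ?thesis unfolding partial_partition_def by (auto intro!: exI[of _ "{}"])
qed

text \<open>A set \<open>X\<close> from \<open>next_part\<close>, taken in one uncovered component
  \<open>C\<close>, becomes part \<open>k\<close>. What remains of \<open>C\<close> receives new
  branch sets; the other components keep theirs.\<close>

lemma partial_partition_extend:
  assumes P: "partial_partition s (t - 1) A k f R" and "A \<noteq> V"
    and t: "2 \<le> t" and free: "\<nexists>M. minor_model (K_star s t) V E M"
  obtains A' f' R' where "A \<subset> A'" "partial_partition s (t - 1) A' (Suc k) f' R'"
proof -
  have AV: "A \<subseteq> V" and fk: "\<And>v. v \<in> A \<Longrightarrow> f v < k"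
    and R: "\<And>i. i < k \<Longrightarrow> R i \<subseteq> {..<i} \<and> card (R i) \<le> s \<and> (0 < i \<longrightarrow> (\<exists>p<i. R i \<subseteq> insert p (R p)))"
    and edge: "\<And>u v. u \<in> A \<Longrightarrow> v \<in> A \<Longrightarrow> (u, v) \<in> E \<Longrightarrow> f u = f v \<or> f u \<in> R (f v) \<or> f v \<in> R (f u)"
    and cov: "\<And>i. i < k \<Longrightarrow> covered (t - 1) {v \<in> A. f v = i}"
    and comp: "\<And>C. component E (V - A) C \<Longrightarrow>
        \<exists>p<k. \<exists>Q B. Q \<subseteq> insert p (R p) \<and> card Q \<le> s \<and> branch_sets f C Q B"
    using P unfolding partial_partition_def by blast+
  obtain x where "x \<in> V - A" using AV assms(2) by auto
  then obtain C where C: "component E (V - A) C"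
    using component_of[OF sym_E, of "V - A" x] finite_V by auto
  have c: "C \<subseteq> V" "C \<inter> A = {}" "C \<noteq> {}" "conn_set E C" using C unfolding component_def by auto
  obtain p Q B where p: "p < k" "Q \<subseteq> insert p (R p)" "card Q \<le> s" and B: "branch_sets f C Q B"
    using comp[OF C] by blast
  have Qk: "Q \<subseteq> {..<k}" using p R[OF p(1)] by fastforce
  have kQ: "k \<notin> Q" using Qk by auto
  have finQ: "finite Q" using B unfolding branch_sets_def by auto
  obtain X where X: "X \<subseteq> C" "X \<noteq> {}" "covered (t - 1) X"
    and split: "\<forall>C'. component E (C - X) C' \<longrightarrow>
       card Q < s \<and> (\<forall>r\<in>Q. touches E C' (B r)) \<and>
       (\<exists>D. X \<subseteq> D \<and> D \<subseteq> C \<and> conn_set E D \<and> D \<inter> C' = {} \<and> (\<forall>r\<in>Q. touches E D (B r)))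
       \<or> (\<exists>r\<in>Q. \<not> touches E C' (B r) \<and> conn_set E (B r \<union> (C - C')))"
    by (rule next_part[OF c(1,3,4) B p(3) t free])
  define f' where "f' = (\<lambda>v. if v \<in> X then k else f v)"
  \<comment> \<open>All covered neighbours of \<open>C\<close> lie in parts indexed by
    \<open>Q\<close>, and \<open>Q \<subseteq> insert p (R p)\<close> makes \<open>p\<close> the
    parent of the new node \<open>k\<close>.\<close>
  define R' where "R' = R(k := Q)"
  have XA: "X \<inter> A = {}" using X c by auto
  have f'A: "f' v = f v" if "v \<in> A" for v using that XA unfolding f'_def by auto
  have nb: "f y \<in> Q \<and> y \<in> B (f y) \<and> f' y = f y" if "c \<in> C" "(c, y) \<in> E" "y \<notin> C" for c y
  proof -
    have "y \<in> A" using that C E_sub unfolding component_def by blast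
    then show ?thesis using that B f'A unfolding branch_sets_def by auto
  qed
  have Bd: "B r \<subseteq> V" "B r \<noteq> {}" "conn_set E (B r)" "B r \<inter> C = {}" if "r \<in> Q" for r
    using that B unfolding branch_sets_def by auto
  have Bp: "B r \<inter> B q = {}" "touches E (B r) (B q)" if "r \<in> Q" "q \<in> Q" "r \<noteq> q" for r q
    using that B unfolding branch_sets_def by auto
  \<comment> \<open>Since \<open>C\<close> is connected, every component of \<open>C - X\<close> is
    adjacent to \<open>X\<close>; hence \<open>k\<close> joins its index set in both cases.\<close>
  have inner: "\<exists>Q' B'. Q' \<subseteq> insert k Q \<and> card Q' \<le> s \<and> branch_sets f' C' Q' B'"
    if C': "component E (C - X) C'" for C'
  proof -
    have c': "C' \<subseteq> C" "C' \<noteq> {}" "conn_set E C'" "C' \<inter> X = {}" using C' unfolding component_def by auto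
    obtain x where x: "x \<in> C'" using c' by auto
    obtain y where y: "y \<in> X" using X by auto
    obtain u v where uv: "u \<in> C'" "v \<in> C" "v \<notin> C'" "(u, v) \<in> E"
      using conn_set_crossing[OF c(4), of x C' y] x y c' X by blast
    then have vX: "v \<in> X" using C' unfolding component_def by auto
    have touchX: "touches E C' S" if "X \<subseteq> S" for S using uv vX that unfolding touches_def by blast
    have nbC': "y \<in> X \<and> f' y = k \<or> f y \<in> Q \<and> y \<in> B (f y) \<and> f' y = f y \<and> touches E C' (B (f y))"
      if "c \<in> C'" "(c, y) \<in> E" "y \<notin> C'" for c y
    proof (cases "y \<in> C")
      case True
      then have "y \<in> X" using that C' unfolding component_def by auto
      then show ?thesis by (simp add: f'_def)
    next
      case False
      then show ?thesis using nb[of c y] that c' unfolding touches_def by blast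
    qed
    from split[rule_format, OF C'] show ?thesis
    proof (elim disjE conjE exE bexE)
      fix D assume D: "card Q < s" "\<forall>r\<in>Q. touches E C' (B r)" "X \<subseteq> D" "D \<subseteq> C" "conn_set E D" 
        "D \<inter> C' = {}" "\<forall>r\<in>Q. touches E D (B r)"
      \<comment> \<open>All old branch sets are still touched. \<open>D\<close> contains part
        \<open>k\<close> and avoids \<open>C'\<close>, so it is the branch set for
        \<open>k\<close>.\<close>
      have "branch_sets f' C' (insert k Q) (B(k := D))"
        unfolding branch_sets_def
      proof (intro conjI)
        show "\<forall>r\<in>insert k Q. (B(k := D)) r \<subseteq> V \<and> (B(k := D)) r \<noteq> {} \<and> conn_set E ((B(k := D)) r) \<and>
          (B(k := D)) r \<inter> C' = {} \<and> touches E C' ((B(k := D)) r)"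
          using D Bd c' c(1) y touchX[OF D(3)] kQ by (auto simp: fun_upd_def) blast+
        show "\<forall>r\<in>insert k Q. \<forall>q\<in>insert k Q. r \<noteq> q \<longrightarrow>
          (B(k := D)) r \<inter> (B(k := D)) q = {} \<and> touches E ((B(k := D)) r) ((B(k := D)) q)"
        proof (intro ballI impI)
          fix r q assume rq: "r \<in> insert k Q" "q \<in> insert k Q" "r \<noteq> q"
          have DB: "D \<inter> B r = {}" "touches E D (B r)" "touches E (B r) D" if "r \<in> Q" for r
            using D that Bd(4)[OF that] touches_sym[OF sym_E] by auto
          then show "(B(k := D)) r \<inter> (B(k := D)) q = {} \<and> touches E ((B(k := D)) r) ((B(k := D)) q)"
            using rq Bp[of r q] by (auto simp: Int_commute)
        qed
        show "\<forall>c\<in>C'. \<forall>y. (c, y) \<in> E \<longrightarrow> y \<notin> C' \<longrightarrow> f' y \<in> insert k Q \<and> y \<in> (B(k := D)) (f' y)"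
          using nbC' D(3) kQ by fastforce
      qed (use finQ in simp)
      moreover have "card (insert k Q) \<le> s" using D(1) finQ by (simp add: card_insert_if)
      ultimately show ?thesis by blast
    next
      fix r0 assume r0: "r0 \<in> Q" "\<not> touches E C' (B r0)" and con: "conn_set E (B r0 \<union> (C - C'))"
      \<comment> \<open>Here \<open>C'\<close> misses \<open>B r0\<close>. Only touched indices are
        kept, and \<open>B r0\<close>, already adjacent to the other branch sets, is enlarged by
        \<open>C - C'\<close> to serve for \<open>k\<close>. Dropping \<open>r0\<close> makes up for
        adding \<open>k\<close>.\<close>
      define Q0 where "Q0 = {r \<in> Q. touches E C' (B r)}"
      define D where "D = B r0 \<union> (C - C')"
      have Q0: "Q0 \<subseteq> Q - {r0}" using r0 unfolding Q0_def by auto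
      have XD: "X \<subseteq> D" using X c' unfolding D_def by auto
      have kQ0: "k \<notin> Q0" using kQ unfolding Q0_def by auto
      have DB: "D \<inter> B r = {}" "touches E D (B r)" "touches E (B r) D" if "r \<in> Q0" for r
      proof -
        have "r \<in> Q" "r \<noteq> r0" using that Q0 by auto
        then show "D \<inter> B r = {}" "touches E D (B r)" "touches E (B r) D"
          using Bp[OF r0(1), of r] Bd(4)[of r] touches_mono[of E "B r0" "B r" D "B r"]
            touches_sym[OF sym_E, of D "B r"] unfolding D_def by auto
      qed
      have "branch_sets f' C' (insert k Q0) (B(k := D))"
        unfolding branch_sets_def
      proof (intro conjI)
        have "D \<subseteq> V" "D \<noteq> {}" "D \<inter> C' = {}" using Bd[OF r0(1)] c(1) c' unfolding D_def by auto
        moreover have "conn_set E D" using con unfolding D_def .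
        moreover have "B r \<inter> C' = {}" if "r \<in> Q" for r using Bd(4)[OF that] c' by auto
        ultimately
        show "\<forall>r\<in>insert k Q0. (B(k := D)) r \<subseteq> V \<and> (B(k := D)) r \<noteq> {} \<and> conn_set E ((B(k := D)) r) \<and>
          (B(k := D)) r \<inter> C' = {} \<and> touches E C' ((B(k := D)) r)"
          using Bd(1-3) touchX[OF XD] kQ0 unfolding Q0_def by simp
        show "\<forall>r\<in>insert k Q0. \<forall>q\<in>insert k Q0. r \<noteq> q \<longrightarrow>
          (B(k := D)) r \<inter> (B(k := D)) q = {} \<and> touches E ((B(k := D)) r) ((B(k := D)) q)"
        proof (intro ballI impI)
          fix r q assume rq: "r \<in> insert k Q0" "q \<in> insert k Q0" "r \<noteq> q"
          then show "(B(k := D)) r \<inter> (B(k := D)) q = {} \<and> touches E ((B(k := D)) r) ((B(k := D)) q)"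
            using DB Bp[of r q] subsetD[OF Q0, of r] subsetD[OF Q0, of q] by (auto simp: Int_commute)
        qed
        show "\<forall>c\<in>C'. \<forall>y. (c, y) \<in> E \<longrightarrow> y \<notin> C' \<longrightarrow> f' y \<in> insert k Q0 \<and> y \<in> (B(k := D)) (f' y)"
          using nbC' XD kQ unfolding Q0_def by fastforce
      qed (use finQ in \<open>simp add: Q0_def\<close>)
      moreover have "card (insert k Q0) \<le> s"
      proof -
        have "card Q0 \<le> card (Q - {r0})" using Q0 finQ by (intro card_mono) auto
        also have "\<dots> < card Q" using r0(1) finQ by (intro card_Diff1_less)
        finally show ?thesis using p(3) finQ unfolding Q0_def by (simp add: card_insert_if)
      qed
      moreover have "insert k Q0 \<subseteq> insert k Q" unfolding Q0_def by auto
      ultimately show ?thesis by blast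
    qed
  qed
  have "partial_partition s (t - 1) (A \<union> X) (Suc k) f' R'"
    unfolding partial_partition_def
  proof (intro conjI)
    show "A \<union> X \<subseteq> V" using AV X c by auto
    show "\<forall>v\<in>A \<union> X. f' v < Suc k" using fk unfolding f'_def by (auto intro: less_SucI)
    show "\<forall>i<Suc k. R' i \<subseteq> {..<i} \<and> card (R' i) \<le> s \<and> (0 < i \<longrightarrow> (\<exists>p<i. R' i \<subseteq> insert p (R' p)))"
    proof (intro allI impI)
      fix i assume "i < Suc k"
      show "R' i \<subseteq> {..<i} \<and> card (R' i) \<le> s \<and> (0 < i \<longrightarrow> (\<exists>p<i. R' i \<subseteq> insert p (R' p)))"
      proof (cases "i = k")
        case True
        then show ?thesis using p Qk unfolding R'_def by auto
      next
        case False
        then have "i < k" using \<open>i < Suc k\<close> by auto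
        then have "R' i = R i" "\<And>p. p < i \<Longrightarrow> R' p = R p" unfolding R'_def by auto
        then show ?thesis using R[OF \<open>i < k\<close>] by metis
      qed
    qed
    show "\<forall>u\<in>A \<union> X. \<forall>v\<in>A \<union> X. (u, v) \<in> E \<longrightarrow> f' u = f' v \<or> f' u \<in> R' (f' v) \<or> f' v \<in> R' (f' u)"
    proof (intro ballI impI)
      fix u v assume uv: "u \<in> A \<union> X" "v \<in> A \<union> X" "(u, v) \<in> E"
      have vu: "(v, u) \<in> E" using uv sym_E by (meson symD)
      consider "u \<in> A" "v \<in> A" | "u \<in> X" "v \<in> X" | "u \<in> X" "v \<in> A" | "u \<in> A" "v \<in> X" using uv by auto
      then show "f' u = f' v \<or> f' u \<in> R' (f' v) \<or> f' v \<in> R' (f' u)"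
      proof cases
        case 1
        then show ?thesis using edge[OF 1 uv(3)] f'A fk[of u] fk[of v] unfolding R'_def by auto
      next
        case 2 then show ?thesis unfolding f'_def by auto
      next
        case 3
        then have "v \<notin> C" "u \<in> C" using c X by auto
        then show ?thesis using nb[of u v] uv 3 unfolding f'_def R'_def by auto
      next
        case 4
        then have "u \<notin> C" "v \<in> C" using c X by auto
        then show ?thesis using nb[of v u] vu 4 unfolding f'_def R'_def by auto
      qed
    qed
    show "\<forall>i<Suc k. covered (t - 1) {v \<in> A \<union> X. f' v = i}"
    proof (intro allI impI)
      fix i assume i: "i < Suc k"
      show "covered (t - 1) {v \<in> A \<union> X. f' v = i}"
      proof (cases "i = k")
        case True
        have "f' v \<noteq> k" if "v \<in> A" for v using f'A[OF that] fk[OF that] by simp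
        then have "{v \<in> A \<union> X. f' v = i} \<subseteq> X" using True by auto
        then show ?thesis using covered_subset X(3) by blast
      next
        case False
        then have "{v \<in> A \<union> X. f' v = i} \<subseteq> {v \<in> A. f v = i}" unfolding f'_def by auto
        moreover have "i < k" using i False by simp
        ultimately show ?thesis using covered_subset[OF cov] by blast
      qed
    qed
    show "\<forall>C. component E (V - (A \<union> X)) C \<longrightarrow>
        (\<exists>p<Suc k. \<exists>Q B. Q \<subseteq> insert p (R' p) \<and> card Q \<le> s \<and> branch_sets f' C Q B)"
    proof (intro allI impI)
      fix K assume K: "component E (V - (A \<union> X)) K"
      have k: "K \<noteq> {}" "conn_set E K" "K \<subseteq> V - A" using K unfolding component_def by auto
      show "\<exists>p<Suc k. \<exists>Q B. Q \<subseteq> insert p (R' p) \<and> card Q \<le> s \<and> branch_sets f' K Q B"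
      proof (cases "K \<inter> C = {}")
        case False
        then have "K \<subseteq> C" using component_absorbs[OF C k(2,3)] by auto
        then have "component E (C - X) K" using K c unfolding component_def by blast
        then show ?thesis using inner[of K] unfolding R'_def by (intro exI[of _ k]) auto
      next
        \<comment> \<open>As \<open>K\<close> avoids the component \<open>C\<close>, it has no edge
          to \<open>X\<close>, so it was a component before this step.\<close>
        case True
        have "(u, v) \<notin> E" if "u \<in> K" "v \<in> V - A - K" for u v
        proof (cases "v \<in> X")
          case T: True
          then show ?thesis using C X that k True sym_E unfolding component_def
            by (metis DiffI disjoint_iff subsetD symD)
        next
          case False
          then show ?thesis using K that unfolding component_def by auto
        qed
        then have K': "component E (V - A) K" using k unfolding component_def by auto
        then obtain p1 Q1 B1 where 1: "p1 < k" "Q1 \<subseteq> insert p1 (R p1)" "card Q1 \<le> s" "branch_sets f K Q1 B1"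
          using comp by blast
        have "y \<in> A" if "c \<in> K" "(c, y) \<in> E" "y \<notin> K" for c y
          using that K' E_sub unfolding component_def by blast
        then have "branch_sets f' K Q1 B1" using 1(4) f'A unfolding branch_sets_def by auto
        moreover have "Q1 \<subseteq> insert p1 (R' p1)" using 1 unfolding R'_def by auto
        ultimately show ?thesis using 1 by (meson less_SucI)
      qed
    qed
  qed simp
  moreover have "A \<subset> A \<union> X" using X XA by auto
  ultimately show ?thesis using that by blast
qed

lemma covered_partition_exists:
  assumes "2 \<le> t" "\<nexists>M. minor_model (K_star s t) V E M"
  obtains k f R where "partial_partition s (t - 1) V k f R"
proof -
  have "\<exists>k f R. partial_partition s (t - 1) V k f R"
    if "partial_partition s (t - 1) A k f R" for A k f R
    using that
  proof (induction "card (V - A)" arbitrary: A k f R rule: less_induct)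
    case less
    show ?case
    proof (cases "A = V")
      case False
      obtain A' f' R' where A': "A \<subset> A'" "partial_partition s (t - 1) A' (Suc k) f' R'"
        by (rule partial_partition_extend[OF less.prems False assms])
      then have "V - A' \<subset> V - A" unfolding partial_partition_def by auto
      then have "card (V - A') < card (V - A)" using finite_V by (intro psubset_card_mono) auto
      then show ?thesis using less.hyps A' by blast
    qed (use less in auto)
  qed
  from this[OF partial_partition_empty] show ?thesis using that by blast
qed

end

section \<open>Minors from branch sets\<close>

lemma pair_graphI:
  assumes "finite (pverts G)" "parcs G \<subseteq> pverts G \<times> pverts G" "sym (parcs G)" "irrefl (parcs G)"
  shows "pair_graph G"
proof
  show "finite (parcs G)" using assms(1,2) by (meson finite_SigmaI finite_subset)
  show "symmetric (with_proj G)" using assms(3) by (simp add: symmetric_def)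
qed (use assms in \<open>auto simp: irrefl_def\<close>)

lemma pair_graphD:
  assumes "pair_graph G"
  shows "finite (pverts G)" "parcs G \<subseteq> pverts G \<times> pverts G" "sym (parcs G)" "irrefl (parcs G)"
proof -
  interpret pair_graph G by fact
  show "finite (pverts G)" by simp
  show "parcs G \<subseteq> pverts G \<times> pverts G" using in_arcsD1 in_arcsD2 by auto
  show "sym (parcs G)" using arcs_symmetric by (auto intro: symI)
  show "irrefl (parcs G)" using no_loops' by (auto simp: irrefl_def)
qed

lemma digraph_isoI:
  assumes "pair_graph G" "inj_on g (pverts G)" "pverts G' = g ` pverts G"
    and "parcs G' = map_prod g g ` parcs G"
  shows "digraph_iso (with_proj G) (with_proj G')"
proof -
  interpret pair_graph G by fact
  let ?f = "\<lparr> iso_verts = g, iso_arcs = map_prod g g, iso_head = snd, iso_tail = fst \<rparr>"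
  have "inj_on (map_prod g g) (parcs G)"
    using map_prod_inj_on[OF assms(2,2)] pair_graphD(2)[OF assms(1)] inj_on_subset by blast
  then have "pre_digraph.digraph_isomorphism (with_proj G) ?f"
    using assms(2) wf_digraph_axioms unfolding pre_digraph.digraph_isomorphism_def by auto
  moreover have "with_proj G' = app_iso ?f (with_proj G)"
    using assms by (simp add: app_iso_def with_proj_def)
  ultimately show ?thesis unfolding digraph_iso_def by blast
qed

lemma subgraph_with_projI:
  assumes "pair_graph G" "pair_graph K" "pverts K \<subseteq> pverts G" "parcs K \<subseteq> parcs G"
  shows "subgraph (with_proj K) (with_proj G)"
proof -
  interpret G: pair_graph G by fact
  interpret K: pair_graph K by fact
  show ?thesis using assms G.wf_digraph_axioms K.wf_digraph_axioms by (intro subgraphI) auto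
qed

text \<open>\<open>contracts_to\<close> appends contractions at the end, whereas the next induction
  performs one first.\<close>

lemma contracts_to_head:
  assumes "contracts_to (contract_edge G u v) K" "(u, v) \<in> parcs G"
  shows "contracts_to G K"
  using assms
proof (induction "contract_edge G u v" K rule: contracts_to.induct)
  case refl
  then show ?case by (intro contracts_to.step contracts_to.refl)
next
  case (step G' u v)
  then show ?case by (intro contracts_to.step) auto
qed

lemma conn_set_image:
  assumes "conn_set E S" "\<And>x y. x \<in> S \<Longrightarrow> y \<in> S \<Longrightarrow> (x, y) \<in> E \<Longrightarrow> f x \<noteq> f y \<Longrightarrow> (f x, f y) \<in> E'"
  shows "conn_set E' (f ` S)"
  unfolding conn_set_def
proof (intro allI impI)
  fix P assume P: "P \<subseteq> f ` S" "P \<noteq> {}" "P \<noteq> f ` S"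
  obtain x y where "x \<in> S" "f x \<in> P" "y \<in> S" "f y \<notin> P" using P by blast
  then obtain u v where uv: "u \<in> S" "f u \<in> P" "v \<in> S" "f v \<notin> P" "(u, v) \<in> E"
    using conn_set_crossing[OF assms(1), of x "f -` P" y] by auto
  then have "(f u, f v) \<in> E'" using assms(2)[of u v] by metis
  then show "\<exists>u\<in>P. \<exists>v\<in>f ` S - P. (u, v) \<in> E'" using uv by blast
qed

text \<open>\<open>\<phi>\<close> labels the vertices of \<open>K\<close> by those of
  \<open>X\<close>. While two vertices share a label, their connected fibre has an edge, whose
  contraction preserves all hypotheses. Once \<open>\<phi>\<close> is injective, its inverse is an
  isomorphism.\<close>

lemma contract_connected_fibres:
  fixes K :: "'a pair_pre_digraph" and X :: "'b pair_pre_digraph"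
  assumes "pair_graph K" "pair_graph X" "\<phi> ` pverts K = pverts X"
    and "\<And>i. i \<in> pverts X \<Longrightarrow> conn_set (parcs K) {v \<in> pverts K. \<phi> v = i}"
    and "\<And>i j. (i, j) \<in> parcs X \<longleftrightarrow> i \<noteq> j \<and> (\<exists>x y. (x, y) \<in> parcs K \<and> \<phi> x = i \<and> \<phi> y = j)"
  shows "\<exists>K'. contracts_to K K' \<and> digraph_iso (with_proj X) (with_proj K')"
  using assms
proof (induction "card (pverts K)" arbitrary: K rule: less_induct)
  case less
  note K = pair_graphD[OF less.prems(1)]
  show ?case
  proof (cases "inj_on \<phi> (pverts K)")
    case True
    define g where "g = inv_into (pverts K) \<phi>"
    have g: "g (\<phi> v) = v" if "v \<in> pverts K" for v using True that unfolding g_def by simp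
    have "digraph_iso (with_proj X) (with_proj K)"
    proof (rule digraph_isoI[OF less.prems(2)])
      show "inj_on g (pverts X)" unfolding g_def using less.prems(3) by (simp add: inj_on_inv_into)
      show "pverts K = g ` pverts X" unfolding less.prems(3)[symmetric] using g by (force simp: image_image)
      show "parcs K = map_prod g g ` parcs X"
      proof (intro equalityI subsetI)
        fix e assume "e \<in> parcs K"
        moreover obtain x y where e: "e = (x, y)" by (cases e)
        ultimately have xy: "(x, y) \<in> parcs K" "x \<in> pverts K" "y \<in> pverts K" "x \<noteq> y"
          using K by (auto simp: irrefl_def)
        then have "\<phi> x \<noteq> \<phi> y" using True by (auto simp: inj_on_def)
        then have "(\<phi> x, \<phi> y) \<in> parcs X" using less.prems(5) xy by blast
        then show "e \<in> map_prod g g ` parcs X" using g xy e by (intro image_eqI[of _ _ "(\<phi> x, \<phi> y)"]) auto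
      next
        fix e assume "e \<in> map_prod g g ` parcs X"
        then obtain i j where e: "e = (g i, g j)" "(i, j) \<in> parcs X" by auto
        then obtain x y where xy: "(x, y) \<in> parcs K" "\<phi> x = i" "\<phi> y = j" using less.prems(5) by blast
        then have "g i = x" "g j = y" using g K by auto
        then show "e \<in> parcs K" using e xy by simp
      qed
    qed
    then show ?thesis using contracts_to.refl by blast
  next
    case False
    then obtain u v where uv: "u \<in> pverts K" "v \<in> pverts K" "u \<noteq> v" "\<phi> u = \<phi> v" by (auto simp: inj_on_def)
    have "conn_set (parcs K) {w \<in> pverts K. \<phi> w = \<phi> u}" using less.prems(3,4) uv by blast
    from conn_set_crossing[OF this, of u "{u}" v] uv
    obtain b where b: "b \<in> pverts K" "\<phi> b = \<phi> u" "b \<noteq> u" "(u, b) \<in> parcs K" by auto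
    \<comment> \<open>The map behind \<open>contract_edge K u b\<close>; as \<open>u\<close> and
      \<open>b\<close> share a label, \<open>\<phi>\<close> also labels the contracted
      graph.\<close>
    define h where "h = id(b := u)"
    define K1 where "K1 = contract_edge K u b"
    have V1: "pverts K1 = h ` pverts K"
      and A1: "parcs K1 = {(h x, h y) | x y. (x, y) \<in> parcs K \<and> h x \<noteq> h y}"
      by (auto simp: K1_def contract_edge_def h_def Let_def)
    have h\<phi>: "\<phi> (h x) = \<phi> x" for x using b unfolding h_def by auto
    have "h ` pverts K = pverts K - {b}" using b(1,3) uv(1) unfolding h_def by auto
    then have less1: "card (pverts K1) < card (pverts K)"
      using V1 b K(1) by (simp add: card_Diff1_less del: card_Diff_insert)
    have g1: "pair_graph K1"
    proof (rule pair_graphI)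
      show "finite (pverts K1)" using V1 K by simp
      show "parcs K1 \<subseteq> pverts K1 \<times> pverts K1" using V1 A1 K(2) by auto
      show "sym (parcs K1)" unfolding A1 using K(3) by (auto simp: sym_def; metis)
      show "irrefl (parcs K1)" unfolding A1 by (auto simp: irrefl_def)
    qed
    have "\<exists>K'. contracts_to K1 K' \<and> digraph_iso (with_proj X) (with_proj K')"
    proof (rule less.hyps[OF less1 g1 less.prems(2)])
      show "\<phi> ` pverts K1 = pverts X" using V1 h\<phi> less.prems(3) by (simp add: image_image)
    next
      fix i assume "i \<in> pverts X"
      then have "conn_set (parcs K1) (h ` {v \<in> pverts K. \<phi> v = i})"
        by (intro conn_set_image[OF less.prems(4)]) (auto simp: A1)
      moreover have "h ` {v \<in> pverts K. \<phi> v = i} = {v \<in> pverts K1. \<phi> v = i}"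
        using V1 h\<phi> by auto
      ultimately show "conn_set (parcs K1) {v \<in> pverts K1. \<phi> v = i}" by simp
    next
      fix i j
      have "(\<exists>x y. (x, y) \<in> parcs K1 \<and> \<phi> x = i \<and> \<phi> y = j) \<longleftrightarrow> (\<exists>x y. (x, y) \<in> parcs K \<and> \<phi> x = i \<and> \<phi> y = j)"
        if "i \<noteq> j"
      proof
        assume "\<exists>x y. (x, y) \<in> parcs K1 \<and> \<phi> x = i \<and> \<phi> y = j"
        then obtain a b where "(a, b) \<in> parcs K" "\<phi> (h a) = i" "\<phi> (h b) = j" unfolding A1 by auto
        then show "\<exists>x y. (x, y) \<in> parcs K \<and> \<phi> x = i \<and> \<phi> y = j" unfolding h\<phi> by blast
      next
        assume "\<exists>x y. (x, y) \<in> parcs K \<and> \<phi> x = i \<and> \<phi> y = j"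
        then obtain x y where xy: "(x, y) \<in> parcs K" "\<phi> x = i" "\<phi> y = j" by blast
        then have "h x \<noteq> h y" using h\<phi>[of x] h\<phi>[of y] that by metis
        then have "(h x, h y) \<in> parcs K1" using xy unfolding A1 by blast
        then show "\<exists>x y. (x, y) \<in> parcs K1 \<and> \<phi> x = i \<and> \<phi> y = j" using h\<phi> xy by metis
      qed
      then show "(i, j) \<in> parcs X \<longleftrightarrow> i \<noteq> j \<and> (\<exists>x y. (x, y) \<in> parcs K1 \<and> \<phi> x = i \<and> \<phi> y = j)"
        using less.prems(5) by blast
    qed
    then show ?thesis using contracts_to_head[of K u b] b(4) unfolding K1_def by blast
  qed
qed

text \<open>The subgraph \<open>K\<close> keeps only edges within a branch set or between branch
  sets adjacent in \<open>X\<close>, so that contracting the branch sets gives exactly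
  \<open>X\<close>.\<close>

lemma minor_model_is_minor:
  fixes G :: "'a pair_pre_digraph" and X :: "'b pair_pre_digraph"
  assumes "pair_graph G" "pair_graph X" "minor_model X (pverts G) (parcs G) M"
  shows "is_minor X G"
proof -
  note G = pair_graphD[OF assms(1)] and X = pair_graphD[OF assms(2)]
  have M: "\<And>i. i \<in> pverts X \<Longrightarrow> M i \<subseteq> pverts G" "\<And>i. i \<in> pverts X \<Longrightarrow> M i \<noteq> {}"
    "\<And>i. i \<in> pverts X \<Longrightarrow> conn_set (parcs G) (M i)"
    and t: "\<And>i j. (i, j) \<in> parcs X \<Longrightarrow> touches (parcs G) (M i) (M j)"
    using assms(3) unfolding minor_model_def by blast+
  have uniq: "i = j" if "i \<in> pverts X" "j \<in> pverts X" "x \<in> M i" "x \<in> M j" for i j x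
    using assms(3) that unfolding minor_model_def disjoint_family_on_def by blast
  define \<phi> where "\<phi> x = (THE i. i \<in> pverts X \<and> x \<in> M i)" for x
  have \<phi>: "\<phi> x = i" if "i \<in> pverts X" "x \<in> M i" for x i
    unfolding \<phi>_def using that uniq by (intro the_equality) auto
  define K where "K = \<lparr> pverts = (\<Union>i\<in>pverts X. M i),
    parcs = {(x, y). (x, y) \<in> parcs G \<and> (\<exists>i\<in>pverts X. \<exists>j\<in>pverts X. x \<in> M i \<and> y \<in> M j \<and>
      (i = j \<or> (i, j) \<in> parcs X))} \<rparr>"
  have K: "pair_graph K"
  proof (rule pair_graphI)
    have "pverts K \<subseteq> pverts G" using M(1) by (auto simp: K_def)
    then show "finite (pverts K)" using G(1) finite_subset by auto
    show "parcs K \<subseteq> pverts K \<times> pverts K" by (auto simp: K_def)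
    show "sym (parcs K)" using G(3) X(3) unfolding K_def sym_def by (auto; metis)
    show "irrefl (parcs K)" using G(4) by (auto simp: K_def irrefl_def)
  qed
  have sub: "subgraph (with_proj K) (with_proj G)"
    by (rule subgraph_with_projI[OF assms(1) K]) (use M(1) in \<open>auto simp: K_def\<close>)
  have "\<exists>K'. contracts_to K K' \<and> digraph_iso (with_proj X) (with_proj K')"
  proof (rule contract_connected_fibres[OF K assms(2)])
    show "\<phi> ` pverts K = pverts X"
    proof (intro equalityI subsetI)
      fix i assume i: "i \<in> pverts X"
      then obtain x where "x \<in> M i" using M(2) by blast
      then show "i \<in> \<phi> ` pverts K" using i \<phi>[of i x] by (force simp: K_def)
    qed (use \<phi> in \<open>auto simp: K_def\<close>)
  next
    fix i assume i: "i \<in> pverts X"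
    have "{v \<in> pverts K. \<phi> v = i} = id ` M i" using \<phi> i by (auto simp: K_def)
    moreover have "conn_set (parcs K) (id ` M i)"
      by (rule conn_set_image[OF M(3)[OF i]]) (use i in \<open>auto simp: K_def\<close>)
    ultimately show "conn_set (parcs K) {v \<in> pverts K. \<phi> v = i}" by simp
  next
    fix i j
    show "(i, j) \<in> parcs X \<longleftrightarrow> i \<noteq> j \<and> (\<exists>x y. (x, y) \<in> parcs K \<and> \<phi> x = i \<and> \<phi> y = j)"
    proof
      assume ij: "(i, j) \<in> parcs X"
      then have "i \<in> pverts X" "j \<in> pverts X" "i \<noteq> j" using X by (auto simp: irrefl_def)
      moreover obtain x y where "x \<in> M i" "y \<in> M j" "(x, y) \<in> parcs G"
        using t[OF ij] unfolding touches_def by blast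
      ultimately show "i \<noteq> j \<and> (\<exists>x y. (x, y) \<in> parcs K \<and> \<phi> x = i \<and> \<phi> y = j)"
        using \<phi> ij by (auto simp: K_def)
    next
      assume "i \<noteq> j \<and> (\<exists>x y. (x, y) \<in> parcs K \<and> \<phi> x = i \<and> \<phi> y = j)"
      then show "(i, j) \<in> parcs X" using \<phi> by (auto simp: K_def)
    qed
  qed
  then show ?thesis using K sub unfolding is_minor_def by blast
qed

lemma pair_graph_K_star: "pair_graph (K_star s t)"
  by (rule pair_graphI) (auto simp: sym_def irrefl_def)

section \<open>Tree-decompositions\<close>

text \<open>A side without outgoing edges traps every walk; conversely, the points reachable from
  \<open>u\<close> form such a side.\<close>

lemma rtrancl_on_iff_conn_set:
  assumes "sym E"
  shows "(\<forall>u\<in>S. \<forall>v\<in>S. (u, v) \<in> rtrancl_on S (E\<^sup>s)) \<longleftrightarrow> conn_set E S"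
proof
  have Es: "E\<^sup>s = E" using assms by (auto simp: symcl_def dest: symD)
  show "conn_set E S" if L: "\<forall>u\<in>S. \<forall>v\<in>S. (u, v) \<in> rtrancl_on S (E\<^sup>s)"
    unfolding conn_set_def
  proof (intro allI impI, rule ccontr)
    fix P assume P: "P \<subseteq> S" "P \<noteq> {}" "P \<noteq> S" and no: "\<not> (\<exists>u\<in>P. \<exists>v\<in>S - P. (u, v) \<in> E)"
    obtain u v where uv: "u \<in> P" "v \<in> S" "v \<notin> P" using P by blast
    then have "(u, v) \<in> rtrancl_on S E" using L P Es by auto
    then have "v \<in> P"
      by (induction rule: rtrancl_on_induct) (use uv no in auto)
    then show False using uv by simp
  qed
  show "\<forall>u\<in>S. \<forall>v\<in>S. (u, v) \<in> rtrancl_on S (E\<^sup>s)" if R: "conn_set E S"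
  proof (intro ballI)
    fix u v assume u: "u \<in> S" and v: "v \<in> S"
    have "S \<subseteq> {w. (u, w) \<in> rtrancl_on S E}"
    proof (rule conn_set_subset_side[OF R u])
      fix a b assume "a \<in> {w. (u, w) \<in> rtrancl_on S E}" "b \<in> S" "(a, b) \<in> E"
      then show "b \<in> {w. (u, w) \<in> rtrancl_on S E}" by (auto intro: rtrancl_on_into_rtrancl_on)
    qed (use u in auto)
    then show "(u, v) \<in> rtrancl_on S (E\<^sup>s)" using v Es by auto
  qed
qed

lemma conn_set_edges_mono:
  assumes "conn_set E S" "\<And>x y. x \<in> S \<Longrightarrow> y \<in> S \<Longrightarrow> (x, y) \<in> E \<Longrightarrow> (x, y) \<in> E'"
  shows "conn_set E' S"
  using conn_set_image[OF assms(1), of id E'] assms(2) by simp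

lemma conn_set_restrict: "conn_set (E \<inter> S \<times> S) S \<longleftrightarrow> conn_set E S"
  using conn_set_edges_mono[of "E \<inter> S \<times> S" S E] conn_set_edges_mono[of E S "E \<inter> S \<times> S"] by auto

lemma connected_iff_conn_set:
  assumes "sym (parcs T)"
  shows "Digraph_Component.connected (with_proj T) \<longleftrightarrow> pverts T \<noteq> {} \<and> conn_set (parcs T) (pverts T)"
  unfolding connected_conv using rtrancl_on_iff_conn_set[OF assms] by simp

lemma connected_induce_iff_conn_set:
  assumes "sym (parcs T)"
  shows "Digraph_Component.connected (with_proj T \<restriction> S) \<longleftrightarrow> S \<noteq> {} \<and> conn_set (parcs T) S"
proof -
  have "arcs_ends (with_proj T \<restriction> S) = parcs T \<inter> S \<times> S"
    by (auto simp: arcs_ends_conv)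
  moreover have "sym (parcs T \<inter> S \<times> S)" using assms by (auto simp: sym_def)
  ultimately show ?thesis
    unfolding connected_conv using rtrancl_on_iff_conn_set[of "parcs T \<inter> S \<times> S" S] conn_set_restrict[of "parcs T" S]
    by simp
qed

text \<open>Every edge of a tree is a bridge: a path from \<open>b\<close> to \<open>a\<close>
  avoiding it would close up to a cycle.\<close>

lemma undirected_tree_edge_cut:
  assumes T: "undirected_tree T" "(a, b) \<in> parcs T"
    and S: "S \<subseteq> pverts T" "conn_set (parcs T - {(a, b), (b, a)}) S" "a \<in> S" "b \<in> S"
  shows False
proof -
  interpret T: pair_graph T using T unfolding undirected_tree_def by auto
  define T' where "T' = \<lparr> pverts = pverts T, parcs = parcs T - {(a, b), (b, a)} \<rparr>"
  interpret T': pair_wf_digraph T'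
    by unfold_locales (auto simp: T'_def T.arc_fst_in_verts T.arc_snd_in_verts)
  have ab: "a \<noteq> b" using T.no_loops' T(2) by auto
  have "S \<subseteq> {w. b \<rightarrow>\<^sup>*\<^bsub>with_proj T'\<^esub> w}"
  proof (rule conn_set_subset_side[OF S(2,4)])
    have "b \<in> pverts T'" using S by (auto simp: T'_def)
    then show "b \<in> {w. b \<rightarrow>\<^sup>*\<^bsub>with_proj T'\<^esub> w}" using T'.reachable_refl by auto
    fix u v assume uv: "u \<in> {w. b \<rightarrow>\<^sup>*\<^bsub>with_proj T'\<^esub> w}" "(u, v) \<in> parcs T - {(a, b), (b, a)}"
    then have "u \<rightarrow>\<^bsub>with_proj T'\<^esub> v" by (auto simp: T'_def)
    then show "v \<in> {w. b \<rightarrow>\<^sup>*\<^bsub>with_proj T'\<^esub> w}" using uv T'.reachable_adj_trans by auto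
  qed
  then have "b \<rightarrow>\<^sup>*\<^bsub>with_proj T'\<^esub> a" using S by auto
  then obtain p where p: "T'.apath b p a" using T'.reachable_apath by auto
  then have p': "b \<in> pverts T" "set p \<subseteq> parcs T - {(a, b), (b, a)}" "pcas b p a" "distinct (pawalk_verts b p)"
    unfolding T'.apath_def T'.awalk_def by (auto simp: T'_def)
  \<comment> \<open>The empty path would give \<open>a = b\<close>, and a single arc would be the
    deleted \<open>(b, a)\<close>. So the cycle has the length of at least 3 that
    \<open>undirected_tree\<close> forbids.\<close>
  have "2 \<le> length p"
  proof (rule ccontr)
    assume "\<not> 2 \<le> length p"
    then consider "p = []" | e where "p = [e]" by (cases p; cases "tl p") auto
    then show False by cases (use p' ab in auto)
  qed
  moreover have "T.cycle ((a, b) # p)"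
    unfolding T.cycle_def T.awalk_def using p' T(2) T.in_arcsD1 by (intro exI[of _ a]) auto
  ultimately show False using T(1) unfolding undirected_tree_def
    by (metis Suc_le_mono length_Cons numeral_2_eq_2 numeral_3_eq_3)
qed

text \<open>A nonempty proper prefix has an edge leaving it, whose far end is appended.\<close>

lemma connected_enumeration:
  assumes "finite S" "sym E" "conn_set E S" "0 < k" "k \<le> card S"
  shows "\<exists>xs. distinct xs \<and> length xs = k \<and> set xs \<subseteq> S \<and> (\<forall>i<k. 0 < i \<longrightarrow> (\<exists>j<i. (xs ! j, xs ! i) \<in> E))"
  using assms(4,5)
proof (induction k)
  case (Suc k)
  show ?case
  proof (cases "k = 0")
    case True
    then obtain x where "x \<in> S" using Suc assms(1) by fastforce
    then show ?thesis using True by (intro exI[of _ "[x]"]) auto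
  next
    case False
    then obtain xs where xs: "distinct xs" "length xs = k" "set xs \<subseteq> S"
      "\<And>i. i < k \<Longrightarrow> 0 < i \<Longrightarrow> \<exists>j<i. (xs ! j, xs ! i) \<in> E" using Suc by auto
    have "set xs \<noteq> S" using xs Suc.prems distinct_card[of xs] by auto
    moreover have "set xs \<noteq> {}" using xs False by auto
    ultimately obtain u v where uv: "u \<in> set xs" "v \<in> S - set xs" "(u, v) \<in> E"
      using assms(3) xs(3) unfolding conn_set_def by blast
    then obtain j where j: "j < k" "xs ! j = u" using xs by (auto simp: in_set_conv_nth)
    have "\<exists>j<i. ((xs @ [v]) ! j, (xs @ [v]) ! i) \<in> E" if i: "i < Suc k" "0 < i" for i
    proof (cases "i = k")
      case True
      then show ?thesis using j uv xs by (intro exI[of _ j]) (auto simp: nth_append)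
    next
      case False
      then obtain j where "j < i" "(xs ! j, xs ! i) \<in> E" using xs(4)[of i] i by auto
      then show ?thesis using xs(2) False i by (intro exI[of _ j]) (auto simp: nth_append)
    qed
    then show ?thesis using xs uv by (intro exI[of _ "xs @ [v]"]) auto
  qed
qed simp

text \<open>The nodes are listed so that each one after the first has an earlier neighbour, which
  becomes its parent. Parent-closure then follows from the bridge property.\<close>

lemma tree_decomposition_imp_bag_tree:
  fixes T :: "'b pair_pre_digraph"
  assumes G: "pair_graph G" and td: "tree_decomposition G T W"
  obtains n par W' where "bag_tree (pverts G) (parcs G) n par W'" "\<And>i. i < n \<Longrightarrow> \<exists>x\<in>pverts T. W' i = W x"
proof -
  have ut: "undirected_tree T" and edge: "\<And>v w. (v, w) \<in> parcs G \<Longrightarrow> \<exists>x\<in>pverts T. v \<in> W x \<and> w \<in> W x"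
    and con: "\<And>v. v \<in> pverts G \<Longrightarrow> Digraph_Component.connected (with_proj T \<restriction> {x \<in> pverts T. v \<in> W x})"
    using td unfolding tree_decomposition_def by blast+
  have gT: "pair_graph T" and cT: "Digraph_Component.connected (with_proj T)"
    using ut unfolding undirected_tree_def by auto
  note T = pair_graphD[OF gT] and GG = pair_graphD[OF G]
  have cs: "pverts T \<noteq> {}" "conn_set (parcs T) (pverts T)" using cT connected_iff_conn_set[OF T(3)] by auto
  have csv: "{x \<in> pverts T. v \<in> W x} \<noteq> {}" "conn_set (parcs T) {x \<in> pverts T. v \<in> W x}" if "v \<in> pverts G" for v
    using con[OF that] connected_induce_iff_conn_set[OF T(3)] by auto
  define n where "n = card (pverts T)"
  have n: "0 < n" using cs T(1) unfolding n_def by (simp add: card_gt_0_iff)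
  obtain xs where xs: "distinct xs" "length xs = n" "set xs \<subseteq> pverts T"
    and ex: "\<And>i. i < n \<Longrightarrow> 0 < i \<Longrightarrow> \<exists>j<i. (xs ! j, xs ! i) \<in> parcs T"
    using connected_enumeration[OF T(1,3) cs(2) n] unfolding n_def by auto
  have set_xs: "set xs = pverts T" using xs T(1) distinct_card[OF xs(1)] n_def
    by (metis card_subset_eq)
  define par where "par i = (SOME j. j < i \<and> (xs ! j, xs ! i) \<in> parcs T)" for i
  have par: "par i < i" "(xs ! par i, xs ! i) \<in> parcs T" if "0 < i" "i < n" for i
    using someI_ex[OF ex[OF that(2,1)]] unfolding par_def by auto
  have node: "\<exists>i<n. xs ! i = x" if "x \<in> pverts T" for x
    using that xs set_xs by (metis in_set_conv_nth)
  have prefix: "conn_set (parcs T) ((!) xs ` {..<i})" if "i \<le> n" for i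
    using that
  proof (induction i)
    case (Suc i)
    show ?case
    proof (cases "i = 0")
      case False
      have "conn_set (parcs T) ((!) xs ` {..<i} \<union> {xs ! i})"
      proof (rule conn_set_Un[OF T(3)])
        show "(!) xs ` {..<i} \<inter> {xs ! i} \<noteq> {} \<or> touches (parcs T) ((!) xs ` {..<i}) {xs ! i}"
          using par[of i] Suc.prems False by (auto simp: touches_def)
      qed (use Suc in auto)
      then show ?thesis by (simp add: lessThan_Suc)
    qed (simp add: lessThan_Suc)
  qed (simp add: conn_set_def)
  have "bag_tree (pverts G) (parcs G) n par (\<lambda>i. W (xs ! i))"
  proof
    fix u v assume "(u, v) \<in> parcs G"
    then show "\<exists>i<n. u \<in> W (xs ! i) \<and> v \<in> W (xs ! i)" using edge node by metis
  next
    fix v assume v: "v \<in> pverts G"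
    show "\<exists>i<n. v \<in> W (xs ! i)" using csv(1)[OF v] node by fastforce
    let ?N = "{x \<in> pverts T. v \<in> W x}"
    show "parent_closed par {i. i < n \<and> v \<in> W (xs ! i)}"
      unfolding parent_closed_def
    proof (intro ballI impI, rule ccontr)
      fix i j assume i: "i \<in> {i. i < n \<and> v \<in> W (xs ! i)}" and j: "j \<in> {i. i < n \<and> v \<in> W (xs ! i)}" "j < i"
        and np: "par i \<notin> {i. i < n \<and> v \<in> W (xs ! i)}"
      have p: "par i < i" "(xs ! par i, xs ! i) \<in> parcs T" using par[of i] i j by auto
      \<comment> \<open>The set \<open>?N\<close> misses the parent and the prefix \<open>?P\<close>
        misses node \<open>i\<close>, so both are connected without the edge between these two. They
        meet in node \<open>j\<close>, and their union contains both ends of the deleted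
        edge.\<close>
      let ?E = "parcs T - {(xs ! par i, xs ! i), (xs ! i, xs ! par i)}"
      let ?P = "(!) xs ` {..<i}"
      have nN: "xs ! par i \<notin> ?N" using np p i by auto
      have nP: "xs ! i \<notin> ?P" using xs(1,2) i by (auto simp: nth_eq_iff_index_eq)
      have "conn_set ?E ?N"
        by (rule conn_set_edges_mono[OF csv(2)[OF v]]) (use nN in auto)
      moreover have "conn_set ?E ?P"
      proof (rule conn_set_edges_mono[OF prefix[of i]])
        fix x y assume "x \<in> ?P" "y \<in> ?P" and xy: "(x, y) \<in> parcs T"
        then have "x \<noteq> xs ! i" "y \<noteq> xs ! i" using nP by metis+
        then show "(x, y) \<in> ?E" using xy by blast
      qed (use i in auto)
      moreover have "xs ! j \<in> ?N \<inter> ?P" using j nth_mem[of j xs] xs(2,3) by auto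
      moreover have "sym ?E" using T(3) by (auto simp: sym_def)
      ultimately have "conn_set ?E (?N \<union> ?P)" by (intro conn_set_Un) auto
      then show False
      proof (rule undirected_tree_edge_cut[OF ut p(2), rotated])
        have "xs ! k \<in> pverts T" if "k < n" for k using nth_mem[of k xs] xs(2,3) that by auto
        then show "?N \<union> ?P \<subseteq> pverts T" "xs ! i \<in> ?N \<union> ?P" using i by auto
        show "xs ! par i \<in> ?N \<union> ?P" using p(1) by auto
      qed
    qed
  qed (use GG par in auto)
  moreover have "\<exists>x\<in>pverts T. W (xs ! i) = W x" if "i < n" for i
    using nth_mem[of i xs] xs(2,3) that by blast
  ultimately show ?thesis using that by blast
qed

section \<open>From numbered trees back to tree-decompositions\<close>

definition parent_tree :: "nat \<Rightarrow> (nat \<Rightarrow> nat) \<Rightarrow> nat pair_pre_digraph" where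
  "parent_tree n par = \<lparr> pverts = {..<n},
     parcs = {(i, j). i < n \<and> j < n \<and> (0 < i \<and> j = par i \<or> 0 < j \<and> i = par j)} \<rparr>"

lemma parent_tree_simps [simp]:
  "pverts (parent_tree n par) = {..<n}"
  "(i, j) \<in> parcs (parent_tree n par) \<longleftrightarrow> i < n \<and> j < n \<and> (0 < i \<and> j = par i \<or> 0 < j \<and> i = par j)"
  by (auto simp: parent_tree_def)

lemma pcas_nth:
  assumes "pcas u p v"
  shows "\<And>i. Suc i < length p \<Longrightarrow> fst (p ! Suc i) = snd (p ! i)"
    and "p \<noteq> [] \<Longrightarrow> fst (p ! 0) = u \<and> snd (p ! (length p - 1)) = v"
proof -
  show "fst (p ! Suc i) = snd (p ! i)" if "Suc i < length p" for i
    using assms that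
  proof (induction p arbitrary: u i)
    case (Cons e p)
    then show ?case by (cases i; cases p) auto
  qed simp
  show "fst (p ! 0) = u \<and> snd (p ! (length p - 1)) = v" if "p \<noteq> []"
    using assms that
  proof (induction p arbitrary: u)
    case (Cons e p)
    then show ?case by (cases p) auto
  qed simp
qed

context
  fixes n :: nat and par :: "nat \<Rightarrow> nat"
  assumes par: "\<And>i. 0 < i \<Longrightarrow> i < n \<Longrightarrow> par i < i"
begin

lemma pair_graph_parent_tree: "pair_graph (parent_tree n par)"
  by (rule pair_graphI) (auto simp: sym_def irrefl_def, metis par less_irrefl)

text \<open>By induction on the number, each node of \<open>A\<close> is on the same side of a cut
  as the least node, because its parent is.\<close>

lemma parent_tree_conn_set:
  assumes A: "A \<subseteq> {..<n}" "parent_closed par A"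
  shows "conn_set (parcs (parent_tree n par)) A"
  unfolding conn_set_def
proof (intro allI impI, rule ccontr)
  let ?E = "parcs (parent_tree n par)"
  fix P assume P: "P \<subseteq> A" "P \<noteq> {}" "P \<noteq> A" and no: "\<not> (\<exists>u\<in>P. \<exists>v\<in>A - P. (u, v) \<in> ?E)"
  define m where "m = (LEAST m. m \<in> A)"
  obtain a where a: "a \<in> A" using P by blast
  have m: "m \<in> A" "\<And>a. a \<in> A \<Longrightarrow> m \<le> a"
    unfolding m_def by (rule LeastI[of "\<lambda>m. m \<in> A", OF a], rule Least_le)
  have "a \<in> P \<longleftrightarrow> m \<in> P" if "a \<in> A" for a
    using that
  proof (induction a rule: less_induct)
    case (less a)
    show ?case
    proof (cases "a = m")
      case False
      then have "m < a" using m less.prems by (metis le_neq_implies_less)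
      then have pa: "par a \<in> A" "par a < a" "(a, par a) \<in> ?E" "(par a, a) \<in> ?E"
        using A m less.prems par[of a] unfolding parent_closed_def by auto
      then have "a \<in> P \<longleftrightarrow> par a \<in> P" using no less.prems by blast
      then show ?thesis using less.IH pa by blast
    qed simp
  qed
  then show False using P by blast
qed

text \<open>Both neighbours on the cycle of its largest vertex would be the parent of that vertex.\<close>
lemma parent_tree_acyclic:
  assumes "pre_digraph.cycle (with_proj (parent_tree n par)) p" "3 \<le> length p"
  shows False
proof -
  interpret pair_graph "parent_tree n par" by (rule pair_graph_parent_tree)
  define l where "l = length p"
  have l: "3 \<le> l" "0 < l" "p \<noteq> []" using assms unfolding l_def by auto
  obtain u where u: "awalk u p u" "distinct (tl (pawalk_verts u p))" using assms(1) unfolding cycle_def by auto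
  then have arcs: "set p \<subseteq> parcs (parent_tree n par)" and cas: "pcas u p u" unfolding awalk_def by auto
  have "distinct (map snd p)" using u(2) awalk_verts_conv'[OF cas] l by simp
  define v where "v i = snd (p ! i)" for i
  have inj: "i = j" if "v i = v j" "i < l" "j < l" for i j
    using \<open>distinct (map snd p)\<close> that unfolding v_def l_def by (simp add: distinct_conv_nth) metis
  have "fst (p ! Suc i) = v i" if "Suc i < l" for i
    using pcas_nth(1)[OF cas] that unfolding v_def l_def by auto
  moreover have "fst (p ! 0) = v (l - 1)" using pcas_nth(2)[OF cas] l unfolding v_def l_def by auto
  moreover have "(fst (p ! i), v i) \<in> parcs (parent_tree n par)" if "i < l" for i
    using arcs that unfolding v_def l_def by (metis nth_mem prod.collapse subsetD)
  \<comment> \<open>Positions are cyclic: \<open>l - 1\<close> precedes 0, as the closed walk ends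
    where it starts.\<close>
  ultimately have E: "(v (if i = 0 then l - 1 else i - 1), v i) \<in> parcs (parent_tree n par)" if "i < l" for i
    using that by (cases i) (metis diff_Suc_1 nat.distinct(1))+
  obtain m where m: "m < l" "\<And>i. i < l \<Longrightarrow> v i \<le> v m"
  proof -
    have "v ` {..<l} \<noteq> {}" using l(2) by blast
    then have "Max (v ` {..<l}) \<in> v ` {..<l}" by (intro Max_in finite_imageI finite_lessThan)
    then obtain m where "m < l" "Max (v ` {..<l}) = v m" by auto
    moreover have "v i \<le> Max (v ` {..<l})" if "i < l" for i using that by (intro Max_ge) auto
    ultimately show ?thesis using that by auto
  qed
  have nb: "x = par (v m)" if "(x, v m) \<in> parcs (parent_tree n par) \<or> (v m, x) \<in> parcs (parent_tree n par)" "x \<le> v m" for x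
    using that par[of x] par[of "v m"] by fastforce
  \<comment> \<open>The positions before and after \<open>m\<close> on the cycle, distinct because
    \<open>3 \<le> l\<close>.\<close>
  let ?a = "if m = 0 then l - 1 else m - 1" and ?b = "if m = l - 1 then 0 else m + 1"
  have ab: "?a < l" "?b < l" "?a \<noteq> ?b" using m(1) l by (auto split: if_splits)
  have "v ?a = par (v m)" using nb E[OF m(1)] m(2)[OF ab(1)] by blast
  moreover have "(v m, v ?b) \<in> parcs (parent_tree n par)"
  proof (cases "m = l - 1")
    case True then show ?thesis using E[of 0] l by simp
  next
    case False then show ?thesis using E[of "m + 1"] m(1) by simp
  qed
  then have "v ?b = par (v m)" using nb m(2)[OF ab(2)] by blast
  ultimately have "v ?a = v ?b" by (rule trans[OF _ sym])
  then show False using inj[OF _ ab(1,2)] ab(3) by blast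
qed

lemma undirected_tree_parent_tree:
  assumes "0 < n"
  shows "undirected_tree (parent_tree n par)"
proof -
  have "parent_closed par {..<n}" unfolding parent_closed_def
    using par by (metis gr0I lessThan_iff less_trans not_less0)
  then have "conn_set (parcs (parent_tree n par)) {..<n}" by (intro parent_tree_conn_set) auto
  then show ?thesis
    unfolding undirected_tree_def
    using pair_graph_parent_tree connected_iff_conn_set[OF pair_graphD(3)[OF pair_graph_parent_tree]]
      parent_tree_acyclic assms by auto
qed

end

lemma bag_tree_imp_tree_decomposition:
  assumes "bag_tree (pverts G) (parcs G) n par W" "0 < n" "\<And>i. i < n \<Longrightarrow> W i \<subseteq> pverts G"
  shows "tree_decomposition G (parent_tree n par) W"
proof -
  interpret bag_tree "pverts G" "parcs G" n par W by fact
  have pg: "pair_graph (parent_tree n par)" by (rule pair_graph_parent_tree) (rule par_less)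
  have conn: "conn_set (parcs (parent_tree n par)) A" if "A \<subseteq> {..<n}" "parent_closed par A" for A
    by (rule parent_tree_conn_set[OF _ that]) (rule par_less)
  have "Digraph_Component.connected (with_proj (parent_tree n par) \<restriction> {i. i < n \<and> v \<in> W i})"
    if v: "v \<in> pverts G" for v
    unfolding connected_induce_iff_conn_set[OF pair_graphD(3)[OF pg]]
    using vertex_bag[OF v] conn[OF _ vertex_closed[OF v]] by auto
  moreover have "undirected_tree (parent_tree n par)"
    by (rule undirected_tree_parent_tree[OF _ assms(2)]) (rule par_less)
  moreover have "\<exists>i\<in>{..<n}. u \<in> W i \<and> v \<in> W i" if "(u, v) \<in> parcs G" for u v
    using edge_bag[OF that] by auto
  ultimately show ?thesis
    using assms(3) unfolding tree_decomposition_def by auto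
qed

text \<open>The bags \<open>insert i (R i)\<close> have at most \<open>Suc s\<close> elements; the
  index \<open>p\<close> from the assumption is the parent of node \<open>i\<close>.\<close>

lemma elimination_order_treewidth:
  fixes R :: "nat \<Rightarrow> nat set"
  assumes k: "0 < k"
    and R: "\<And>i. i < k \<Longrightarrow> R i \<subseteq> {..<i} \<and> card (R i) \<le> s \<and> (0 < i \<longrightarrow> (\<exists>p<i. R i \<subseteq> insert p (R p)))"
  defines "H \<equiv> \<lparr> pverts = {..<k}, parcs = {(i, j). i < k \<and> j < k \<and> (i \<in> R j \<or> j \<in> R i)} \<rparr>"
  shows "pair_graph H" "treewidth H \<le> int s"
proof -
  have less: "j < i" if "j \<in> R i" "i < k" for i j using R[of i] that by auto
  show "pair_graph H"
    by (rule pair_graphI) (use less in \<open>auto simp: H_def sym_def irrefl_def\<close>)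
  define par where "par i = (SOME p. p < i \<and> R i \<subseteq> insert p (R p))" for i
  have par: "par i < i" "R i \<subseteq> insert (par i) (R (par i))" if "0 < i" "i < k" for i
    using someI_ex[of "\<lambda>p. p < i \<and> R i \<subseteq> insert p (R p)"] R[of i] that unfolding par_def by auto
  have "bag_tree (pverts H) (parcs H) k par (\<lambda>i. insert i (R i))"
  proof
    fix v assume v: "v \<in> pverts H"
    show "parent_closed par {i. i < k \<and> v \<in> insert i (R i)}"
      unfolding parent_closed_def
    proof (intro ballI impI)
      fix i j assume i: "i \<in> {i. i < k \<and> v \<in> insert i (R i)}"
        and j: "j \<in> {i. i < k \<and> v \<in> insert i (R i)}" "j < i"
      \<comment> \<open>Occurring at the earlier node \<open>j\<close> rules out
        \<open>v = i\<close>; so \<open>v\<close> is in \<open>R i\<close>, hence in the parent's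
        bag.\<close>
      have "v \<le> j" using j(1) less[of v j] by auto
      then have "v \<in> R i" using i j(2) by auto
      then show "par i \<in> {i. i < k \<and> v \<in> insert i (R i)}" using par[of i] i j(2) by auto
    qed
  qed (use par in \<open>auto simp: H_def sym_def\<close>)
  then have "tree_decomposition H (parent_tree k par) (\<lambda>i. insert i (R i))"
    by (rule bag_tree_imp_tree_decomposition[OF _ k]) (use less in \<open>force simp: H_def\<close>)
  moreover have "card (insert i (R i)) \<le> Suc s" if "i < k" for i
    using R[OF that] card_insert_le_m1[of "Suc s" "R i" i] by simp
  ultimately have "(LEAST w. \<exists>(T :: nat pair_pre_digraph) W.
      tree_decomposition H T W \<and> (\<forall>x \<in> pverts T. card (W x) \<le> w)) \<le> Suc s"
    by (intro Least_le) (auto intro!: exI[of _ "parent_tree k par"] exI[of _ "\<lambda>i. insert i (R i)"])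
  then show "treewidth H \<le> int s" unfolding treewidth_def by linarith
qed

text \<open>The \<open>LEAST\<close> is attained because some value qualifies: one layer and one
  bag, both the whole vertex set.\<close>

lemma layered_treewidth_attained:
  fixes G :: "'a pair_pre_digraph"
  assumes "pair_graph G"
  obtains L and T :: "nat pair_pre_digraph" and W where "layering G L" "tree_decomposition G T W"
    "\<And>i x. x \<in> pverts T \<Longrightarrow> card (L i \<inter> W x) \<le> layered_treewidth G"
proof -
  note G = pair_graphD[OF assms]
  let ?P = "\<lambda>k. \<exists>L (T :: nat pair_pre_digraph) W. layering G L \<and> tree_decomposition G T W \<and>
        (\<forall>i. \<forall>x \<in> pverts T. card (L i \<inter> W x) \<le> k)"
  define L where "L i = (if i = (0::nat) then pverts G else {})" for i
  have "layering G L" unfolding layering_def L_def disjoint_family_on_def by auto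
  moreover have "bag_tree (pverts G) (parcs G) 1 id (\<lambda>_. pverts G)"
    by unfold_locales (use G in \<open>auto simp: parent_closed_def\<close>)
  then have "tree_decomposition G (parent_tree 1 id) (\<lambda>_. pverts G)"
    by (rule bag_tree_imp_tree_decomposition) auto
  moreover have "card (L i \<inter> pverts G) \<le> card (pverts G)" for i using G(1) by (simp add: card_mono)
  ultimately have "?P (card (pverts G))" by blast
  then have "?P (layered_treewidth G)" unfolding layered_treewidth_def by (rule LeastI)
  then show ?thesis using that by blast
qed

section \<open>Embedding into the strong product\<close>

lemma pair_graph_strong_product:
  assumes "pair_graph A" "pair_graph B"
  shows "pair_graph (A \<boxtimes> B)"
proof (rule pair_graphI)
  note A = pair_graphD[OF assms(1)] and B = pair_graphD[OF assms(2)]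
  show "finite (pverts (A \<boxtimes> B))" using A B by (simp add: strong_product_def)
  show "parcs (A \<boxtimes> B) \<subseteq> pverts (A \<boxtimes> B) \<times> pverts (A \<boxtimes> B)" by (auto simp: strong_product_def)
  show "sym (parcs (A \<boxtimes> B))" using A(3) B(3) by (auto simp: strong_product_def sym_def)
  show "irrefl (parcs (A \<boxtimes> B))" by (auto simp: strong_product_def irrefl_def)
qed

lemma iso_to_subgraphI:
  assumes "pair_graph G" "pair_graph X" "inj_on g (pverts G)" "g ` pverts G \<subseteq> pverts X"
    and "\<And>u v. (u, v) \<in> parcs G \<Longrightarrow> (g u, g v) \<in> parcs X"
  shows "iso_to_subgraph G X"
proof -
  note G = pair_graphD[OF assms(1)]
  define K where "K = \<lparr> pverts = g ` pverts G, parcs = map_prod g g ` parcs G \<rparr>"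
  have "pair_graph K"
  proof (rule pair_graphI)
    show "irrefl (parcs K)" using G(2,4) assms(3) by (auto simp: K_def irrefl_def inj_on_def)
    show "sym (parcs K)" using G(3) by (force simp: K_def sym_def)
  qed (use G in \<open>auto simp: K_def\<close>)
  moreover from this have "subgraph (with_proj K) (with_proj X)"
    by (rule subgraph_with_projI[OF assms(2)]) (use assms in \<open>auto simp: K_def\<close>)
  moreover have "digraph_iso (with_proj G) (with_proj K)"
    by (rule digraph_isoI[OF assms(1,3)]) (simp_all add: K_def)
  ultimately show ?thesis unfolding iso_to_subgraph_def by blast
qed

text \<open>The three coordinates of a vertex are its part, its layer, and its number among the at
  most \<open>m\<close> vertices sharing both.\<close>

lemma layering_iso_to_subgraph:
  fixes G :: "'a pair_pre_digraph" and H :: "nat pair_pre_digraph"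
  assumes G: "pair_graph G" and H: "pair_graph H" and L: "layering G L"
    and f: "\<And>v. v \<in> pverts G \<Longrightarrow> f v \<in> pverts H"
      "\<And>u v. (u, v) \<in> parcs G \<Longrightarrow> f u = f v \<or> (f u, f v) \<in> parcs H"
    and small: "\<And>i j. card {v \<in> pverts G. f v = i \<and> v \<in> L j} \<le> m"
  shows "\<exists>n\<ge>1. iso_to_subgraph G (H \<boxtimes> path_graph n \<boxtimes> complete_graph m)"
proof -
  note GG = pair_graphD[OF G]
  define l where "l v = (THE i. v \<in> L i)" for v
  have l: "l v = i" if "v \<in> L i" for v i
    unfolding l_def using that L by (intro the_equality) (auto simp: layering_def disjoint_family_on_def)
  have vl: "v \<in> L (l v)" if v: "v \<in> pverts G" for v
  proof -
    have "v \<in> (\<Union>i. L i)" using v L unfolding layering_def by simp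
    then obtain i where "v \<in> L i" by blast
    then show ?thesis using l by simp
  qed
  have lay: "l u = l v \<or> l u = Suc (l v) \<or> l v = Suc (l u)" if uv: "(u, v) \<in> parcs G" for u v
  proof -
    have "\<bar>int (l u) - int (l v)\<bar> \<le> 1" using uv vl[of u] vl[of v] GG(2) L unfolding layering_def by blast
    then show ?thesis by linarith
  qed
  \<comment> \<open>Inserting 0 keeps the maximum meaningful for the null graph.\<close>
  define n where "n = Suc (Max (insert 0 (l ` pverts G)))"
  have ln: "l v < n" if "v \<in> pverts G" for v
    unfolding n_def using that GG(1) by (simp add: less_Suc_eq_le)
  define C where "C v = {w \<in> pverts G. f w = f v \<and> w \<in> L (l v)}" for v
  \<comment> \<open>The injection depends on the class only, so all vertices of a class are numbered
    consistently.\<close>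
  define h where "h S = (SOME h. inj_on h S \<and> h ` S \<subseteq> {..<m})" for S :: "'a set"
  have h: "inj_on (h (C v)) (C v)" "h (C v) ` C v \<subseteq> {..<m}" for v
  proof -
    have "finite (C v)" "card (C v) \<le> card {..<m}" using GG(1) small unfolding C_def by auto
    then obtain h' where "inj_on h' (C v)" "h' ` C v \<subseteq> {..<m}" using card_le_inj[of "C v" "{..<m}"] by auto
    then show "inj_on (h (C v)) (C v)" "h (C v) ` C v \<subseteq> {..<m}"
      using someI_ex[of "\<lambda>h. inj_on h (C v) \<and> h ` C v \<subseteq> {..<m}"] unfolding h_def by blast+
  qed
  define g where "g v = ((f v, l v), h (C v) v)" for v
  have vC: "v \<in> C v" if "v \<in> pverts G" for v using that vl unfolding C_def by auto
  have hm: "h (C v) v < m" if "v \<in> pverts G" for v using h(2)[of v] vC[OF that] by auto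
  have inj: "inj_on g (pverts G)"
  proof (rule inj_onI)
    fix u v assume uv: "u \<in> pverts G" "v \<in> pverts G" "g u = g v"
    then have C: "C u = C v" unfolding g_def C_def by simp
    then have "h (C v) u = h (C v) v" "u \<in> C v" using uv vC[OF uv(1)] by (simp_all add: g_def)
    then show "u = v" using inj_onD[OF h(1)[of v]] vC[OF uv(2)] by blast
  qed
  have P: "pair_graph (path_graph n)"
    by (rule pair_graphI) (auto simp: path_graph_def sym_def irrefl_def)
  have K: "pair_graph (complete_graph m)"
    by (rule pair_graphI) (auto simp: complete_graph_def sym_def irrefl_def)
  have "iso_to_subgraph G (H \<boxtimes> path_graph n \<boxtimes> complete_graph m)"
  proof (rule iso_to_subgraphI[OF G _ inj])
    show "pair_graph (H \<boxtimes> path_graph n \<boxtimes> complete_graph m)"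
      by (intro pair_graph_strong_product H P K)
    show "g ` pverts G \<subseteq> pverts (H \<boxtimes> path_graph n \<boxtimes> complete_graph m)"
      using f(1) ln hm by (auto simp: g_def strong_product_def path_graph_def complete_graph_def)
    fix u v assume uv: "(u, v) \<in> parcs G"
    have V: "u \<in> pverts G" "v \<in> pverts G" "u \<noteq> v" using uv GG by (auto simp: irrefl_def)
    have ne: "g u \<noteq> g v" using inj V by (auto simp: inj_on_def)
    have "(f u, l u) = (f v, l v) \<or> ((f u, l u), (f v, l v)) \<in> parcs (H \<boxtimes> path_graph n)"
      using f(1)[OF V(1)] f(1)[OF V(2)] ln[OF V(1)] ln[OF V(2)] f(2)[OF uv] lay[OF uv]
      by (auto simp: strong_product_def path_graph_def)
    moreover have "h (C u) u = h (C v) v \<or> (h (C u) u, h (C v) v) \<in> parcs (complete_graph m)"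
      using hm V by (auto simp: complete_graph_def)
    moreover have "{(f u, l u), (f v, l v)} \<subseteq> pverts (H \<boxtimes> path_graph n)"
      using f(1) ln V by (auto simp: strong_product_def path_graph_def)
    moreover have "{h (C u) u, h (C v) v} \<subseteq> pverts (complete_graph m)"
      using hm V by (auto simp: complete_graph_def)
    ultimately show "(g u, g v) \<in> parcs (H \<boxtimes> path_graph n \<boxtimes> complete_graph m)"
      using ne unfolding g_def strong_product_def[of "H \<boxtimes> path_graph n"] by auto
  qed
  moreover have "1 \<le> n" unfolding n_def by simp
  ultimately show ?thesis by blast
qed

theorem theorem18:
  fixes G :: "'a pair_pre_digraph" and s t :: nat
  assumes "s \<ge> 2" and "t \<ge> 2"
    and "pair_graph G"
    and "minor_free (K_star s t) G"
  shows "\<exists>(H :: nat pair_pre_digraph) n.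
           pair_graph H \<and> treewidth H \<le> int s \<and> n \<ge> 1 \<and>
           iso_to_subgraph G
             (H \<boxtimes> path_graph n \<boxtimes> complete_graph ((t - 1) * layered_treewidth G))"
proof -
  note G = pair_graphD[OF assms(3)]
  let ?w = "layered_treewidth G"
  obtain L and T :: "nat pair_pre_digraph" and W where L: "layering G L" and td: "tree_decomposition G T W"
    and w: "\<And>i x. x \<in> pverts T \<Longrightarrow> card (L i \<inter> W x) \<le> ?w"
    by (rule layered_treewidth_attained[OF assms(3)]) blast
  obtain n par W' where bt: "bag_tree (pverts G) (parcs G) n par W'"
    and W': "\<And>i. i < n \<Longrightarrow> \<exists>x\<in>pverts T. W' i = W x"
    by (rule tree_decomposition_imp_bag_tree[OF assms(3) td]) blast
  interpret bag_tree "pverts G" "parcs G" n par W' by (rule bt)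
  have free: "\<nexists>M. minor_model (K_star s t) (pverts G) (parcs G) M"
    using minor_model_is_minor[OF assms(3) pair_graph_K_star] assms(4) by blast
  obtain k f R where P: "partial_partition s (t - 1) (pverts G) k f R"
    by (rule covered_partition_exists[OF assms(2) free])
  have k: "0 < k" and fk: "\<And>v. v \<in> pverts G \<Longrightarrow> f v < k"
    and R: "\<And>i. i < k \<Longrightarrow> R i \<subseteq> {..<i} \<and> card (R i) \<le> s \<and> (0 < i \<longrightarrow> (\<exists>p<i. R i \<subseteq> insert p (R p)))"
    and edge: "\<And>u v. u \<in> pverts G \<Longrightarrow> v \<in> pverts G \<Longrightarrow> (u, v) \<in> parcs G \<Longrightarrow>
      f u = f v \<or> f u \<in> R (f v) \<or> f v \<in> R (f u)"
    and cov: "\<And>i. i < k \<Longrightarrow> covered (t - 1) {v \<in> pverts G. f v = i}"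
    using P unfolding partial_partition_def by blast+
  \<comment> \<open>\<open>edge\<close> ensures that every edge of \<open>G\<close> between distinct
    parts is mapped to an edge of \<open>H\<close>.\<close>
  define H where "H = \<lparr> pverts = {..<k}, parcs = {(i, j). i < k \<and> j < k \<and> (i \<in> R j \<or> j \<in> R i)} \<rparr>"
  have H: "pair_graph H" "treewidth H \<le> int s"
    unfolding H_def by (rule elimination_order_treewidth[OF k R]; assumption)+
  have "\<exists>n\<ge>1. iso_to_subgraph G (H \<boxtimes> path_graph n \<boxtimes> complete_graph ((t - 1) * ?w))"
  proof (rule layering_iso_to_subgraph[OF assms(3) H(1) L])
    show "f v \<in> pverts H" if "v \<in> pverts G" for v using fk[OF that] by (simp add: H_def)
    show "f u = f v \<or> (f u, f v) \<in> parcs H" if uv: "(u, v) \<in> parcs G" for u v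
    proof -
      have "u \<in> pverts G" "v \<in> pverts G" using G(2) uv by auto
      then show ?thesis using edge[OF _ _ uv] fk[of u] fk[of v] by (simp add: H_def)
    qed
  next
    fix i j
    let ?S = "{v \<in> pverts G. f v = i \<and> v \<in> L j}"
    show "card ?S \<le> (t - 1) * ?w"
    proof (cases "i < k")
      case True
      from cov[OF this] obtain Z where
        Z: "Z \<subseteq> {..<n}" "card Z \<le> t - 1" "{v \<in> pverts G. f v = i} \<subseteq> (\<Union>z\<in>Z. W' z)"
        unfolding covered_def by blast
      have finZ: "finite Z" by (rule finite_subset[OF Z(1)]) simp
      have "L j \<subseteq> pverts G" using L by (auto simp: layering_def)
      then have finL: "finite (L j)" by (rule finite_subset) (rule G(1))
      \<comment> \<open>Part \<open>i\<close> is covered by at most \<open>t - 1\<close> bags, each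
        meeting layer \<open>j\<close> in at most \<open>?w\<close> vertices.\<close>
      have "card ?S \<le> card (\<Union>z\<in>Z. L j \<inter> W' z)"
        using Z(3) finZ finL by (intro card_mono) auto
      also have "\<dots> \<le> (\<Sum>z\<in>Z. card (L j \<inter> W' z))" by (rule card_UN_le[OF finZ])
      also have "\<dots> \<le> of_nat (card Z) * ?w"
      proof (rule sum_bounded_above)
        fix z assume "z \<in> Z"
        then obtain x where "x \<in> pverts T" "W' z = W x" using W'[of z] Z(1) by blast
        then show "card (L j \<inter> W' z) \<le> ?w" using w by simp
      qed
      also have "\<dots> \<le> (t - 1) * ?w" using Z(2) by simp
      finally show ?thesis .
    next
      case False
      then have empty: "?S = {}" using fk by auto
      show ?thesis unfolding empty by simp
    qed
  qed
  then obtain n' where "n' \<ge> 1"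
    "iso_to_subgraph G (H \<boxtimes> path_graph n' \<boxtimes> complete_graph ((t - 1) * ?w))" by blast
  then show ?thesis by (intro exI[of _ H] exI[of _ n'] conjI H)
qed

end
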